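(* Let $N\ge 1$ and let $f\in C^1([0,\infty))\cap C^2((0,\infty))$ satisfy $f(0)=0$, and $f(u)>0$, $f'(u)>0$, $f''(u)>0$ for all $u>0$, and $$F(u):=\int_u^\infty \frac{ds}{f(s)}<\infty\quad\text{for all } u>0 .$$ Assume that the limit $q:=\lim_{s\to+0}f'(s)F(s)$ exists and satisfies $$q<1+\frac N2 .$$ For $\gamma>0$ let $$u_0(x)=F^{-1}\bigl[\gamma^{-1}(|x|^2+1)\bigr],\qquad x\in\mathbb{R}^N .$$ Then there exists a constant $\gamma_*>0$ such that for every $\gamma\in(0,\gamma_* )$ the solution of $$\partial_t u=\Delta u+f(u)\ \text{ in } \mathbb{R}^N\times(0,\infty),\qquad u(x,0)=u_0(x)\ \text{ in } \mathbb{R}^N,$$ exists globally in time.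
   Context: Under the hypotheses on $f$, the function $F:(0,\infty)\to(0,\infty)$ is a strictly decreasing bijection (with $F(u)\to\infty$ as $u\to+0$ and $F(u)\to0$ as $u\to\infty$), and $F^{-1}:(0,\infty)\to(0,\infty)$ denotes its inverse. Existence of the limit $q$ means existence as a real number. A global in time solution (for a bounded continuous nonnegative $u_0$) is a nonnegative function $u\in C^{2,1}(\mathbb{R}^N\times(0,\infty))\cap C(\mathbb{R}^N\times[0,\infty))$, bounded on $\mathbb{R}^N\times[0,T]$ for every $T<\infty$, satisfying the equation pointwise for $t>0$ and $u(\cdot,0)=u_0$. *)

theory Defs
  imports "HOL-Analysis.Analysis"
begin

definition F_of :: "(real \<Rightarrow> real) \<Rightarrow> real \<Rightarrow> real" where
  "F_of f u = (LBINT s:{u..}. 1 / f s)"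

definition F_inv :: "(real \<Rightarrow> real) \<Rightarrow> real \<Rightarrow> real" where
  "F_inv f = inv_into {0<..} (F_of f)"

definition partial_differentiable :: "'n::finite \<Rightarrow> (real ^ 'n \<Rightarrow> real) \<Rightarrow> real ^ 'n \<Rightarrow> bool" where
  "partial_differentiable i g x \<longleftrightarrow> (\<lambda>h. g (x + h *\<^sub>R axis i 1)) field_differentiable (at 0)"

definition partial_deriv :: "'n::finite \<Rightarrow> (real ^ 'n \<Rightarrow> real) \<Rightarrow> real ^ 'n \<Rightarrow> real" where
  "partial_deriv i g x = deriv (\<lambda>h. g (x + h *\<^sub>R axis i 1)) 0"

definition laplacian :: "(real ^ 'n::finite \<Rightarrow> real) \<Rightarrow> real ^ 'n \<Rightarrow> real" where
  "laplacian g x = (\<Sum>i\<in>UNIV. partial_deriv i (partial_deriv i g) x)"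

text \<open>The class C^{2,1} on the product of R^N and (0, infinity): two continuous derivatives in
  space and one in time, continuity being joint in space and time.  Functions of space and time are
  total; their values at negative times play no role.\<close>

definition C21 :: "(real ^ 'n::finite \<Rightarrow> real \<Rightarrow> real) \<Rightarrow> bool" where
  "C21 u \<longleftrightarrow>
     continuous_on (UNIV \<times> {0<..}) (\<lambda>(x, t). u x t) \<and>
     (\<forall>x. \<forall>t>0. (\<lambda>s. u x s) field_differentiable (at t)) \<and>
     continuous_on (UNIV \<times> {0<..}) (\<lambda>(x, t). deriv (\<lambda>s. u x s) t) \<and>
     (\<forall>i. (\<forall>x. \<forall>t>0. partial_differentiable i (\<lambda>y. u y t) x) \<and>
          continuous_on (UNIV \<times> {0<..}) (\<lambda>(x, t). partial_deriv i (\<lambda>y. u y t) x)) \<and>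
     (\<forall>i j. (\<forall>x. \<forall>t>0. partial_differentiable j (partial_deriv i (\<lambda>y. u y t)) x) \<and>
          continuous_on (UNIV \<times> {0<..}) (\<lambda>(x, t). partial_deriv j (partial_deriv i (\<lambda>y. u y t)) x))"

definition global_solution ::
  "(real \<Rightarrow> real) \<Rightarrow> (real ^ 'n::finite \<Rightarrow> real) \<Rightarrow> (real ^ 'n \<Rightarrow> real \<Rightarrow> real) \<Rightarrow> bool" where
  "global_solution f u0 u \<longleftrightarrow>
     C21 u \<and>
     continuous_on (UNIV \<times> {0..}) (\<lambda>(x, t). u x t) \<and>
     (\<forall>x. \<forall>t\<ge>0. 0 \<le> u x t) \<and>
     (\<forall>T. bounded ((\<lambda>(x, t). u x t) ` (UNIV \<times> {0..T}))) \<and>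
     (\<forall>x. \<forall>t>0. deriv (\<lambda>s. u x s) t = laplacian (\<lambda>y. u y t) x + f (u x t)) \<and>
     (\<forall>x. u x 0 = u0 x)"

end

theory Submission
  imports Defs "HOL-Probability.Distributions"
begin

text \<open>
  Choose \<open>m\<close> with \<open>max (q - 1) 0 < m < N/2\<close>, so that \<open>f' (u) F (u) \<le> m + 1\<close> for small \<open>u\<close>, and put
  \<open>A = 1/\<gamma>\<close>. Then \<open>w \<mapsto> F\<^sup>-\<^sup>1 (A w powr (-1/m))\<close> is concave for large \<open>A\<close>, and it turns an explicit radial \<open>w\<close>
  with \<open>w\<^sub>t - \<Delta> w \<ge> (1 + t + |x|\<^sup>2) powr (-m-1)\<close> and \<open>w \<le> C (1 + t + |x|\<^sup>2) powr (-m)\<close> into a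
  bounded global supersolution above the initial value.

  After \<open>f\<close> has been made globally Lipschitz outside the range of the supersolution, the mild
  formulation has a global fixed point. The Gaussian smoothing shows first that it has a continuous
  spatial gradient, and then, applied to the now differentiable source term, that it is a
  classical solution. The comparison principle places it between zero and the supersolution,
  where the modified nonlinearity coincides with \<open>f\<close>.
\<close>

section \<open>Gaussian averages\<close>

text \<open>Pure powers show where the transformation comes from. For f(u) = u^p one has F(u) =
  u^(1-p)/(p-1) and q = p/(p-1), so q < 1 + N/2 is Fujita's condition p > 1 + 2/N, and with m = q -
  1 the transformation is just a multiple of w. In general its second derivative in w has the sign
  of f'(u) F(u) - (m+1), so concavity is exactly the bound that m > q - 1 provides for small u; the
  term with |grad w|^2 then has the favourable sign. The bound m < N/2 enters because (d/dt -
  Laplacian) maps t^(-m) exp(-|x|^2/(4t)) to (N/2 - m)/t times itself. The obstacle on the existence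
  side is regularity: f'' may be unbounded near 0, and the source f(u) comes with no modulus of
  continuity in time. A Leibniz rule along parabolas trades the time derivative of the Duhamel
  integral for a radial space derivative of the source, so a continuous bounded gradient is enough.
  That gradient must stay bounded down to t = 0, which is why the gradient of the initial value is
  estimated.\<close>

lemma continuous_antiderivative:
  fixes p :: "real \<Rightarrow> real"
  assumes p: "continuous_on UNIV p"
  obtains P where "\<And>x. (P has_real_derivative p x) (at x)"
proof -
  have "((\<lambda>u. LBINT y=ereal 0..u. p y) has_real_derivative p x) (at x)" for x
  proof -
    have "((\<lambda>u. LBINT y=ereal 0..u. p y) has_vector_derivative p x) (at x within {-\<bar>x\<bar>-1..\<bar>x\<bar>+1})"
      by (rule interval_integral_FTC2[OF _ _ continuous_on_subset[OF p]]) auto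
    moreover have "x \<in> interior {-\<bar>x\<bar>-1..\<bar>x\<bar>+1}"
      by (auto simp: abs_if)
    ultimately show ?thesis
      unfolding has_real_derivative_iff_has_vector_derivative by (simp only: at_within_interior)
  qed
  then show ?thesis
    using that by blast
qed

text \<open>Domination is asked only on a neighbourhood of \<open>p0\<close>, because the sources
  met later are bounded only up to each finite time. Dominated convergence is applied to the tail of
  the sequence that lies in \<open>U\<close>.\<close>

lemma isCont_integral_dominated:
  fixes k :: "'p::metric_space \<Rightarrow> 'z \<Rightarrow> 'b::{banach, second_countable_topology}"
  assumes meas: "\<And>p. k p \<in> borel_measurable M"
    and cont: "\<And>z. isCont (\<lambda>p. k p z) p0"
    and U: "open U" "p0 \<in> U"
    and bound: "\<And>p z. p \<in> U \<Longrightarrow> norm (k p z) \<le> w z"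
    and w: "integrable M w"
  shows "isCont (\<lambda>p. \<integral>z. k p z \<partial>M) p0"
  unfolding continuous_at_sequentially
proof (intro allI impI)
  fix X assume X: "X \<longlonglongrightarrow> p0"
  obtain n0 where n0: "\<And>n. n \<ge> n0 \<Longrightarrow> X n \<in> U"
    using topological_tendstoD[OF X U] unfolding eventually_sequentially by blast
  have "(\<lambda>n. \<integral>z. k (X (n + n0)) z \<partial>M) \<longlonglongrightarrow> (\<integral>z. k p0 z \<partial>M)"
  proof (rule integral_dominated_convergence)
    show "AE z in M. (\<lambda>n. k (X (n + n0)) z) \<longlonglongrightarrow> k p0 z"
      using isCont_tendsto_compose[OF cont LIMSEQ_ignore_initial_segment[OF X]] by auto
  qed (use meas w bound n0 in auto)
  from LIMSEQ_offset[OF this] show "((\<lambda>p. \<integral>z. k p z \<partial>M) \<circ> X) \<longlonglongrightarrow> (\<integral>z. k p0 z \<partial>M)"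
    by (simp add: o_def)
qed

text \<open>The mean value inequality bounds the difference quotients by the same \<open>w\<close>
  that bounds the derivatives, so dominated convergence applies to them.\<close>

lemma has_real_derivative_integral_dominated:
  fixes k :: "real \<Rightarrow> 'z \<Rightarrow> real"
  assumes d: "d > 0"
    and int: "\<And>a. \<bar>a - a0\<bar> < d \<Longrightarrow> integrable M (k a)"
    and meas: "k' a0 \<in> borel_measurable M"
    and deriv: "\<And>a z. \<bar>a - a0\<bar> < d \<Longrightarrow> ((\<lambda>a. k a z) has_real_derivative k' a z) (at a)"
    and bound: "\<And>a z. \<bar>a - a0\<bar> < d \<Longrightarrow> \<bar>k' a z\<bar> \<le> w z"
    and w: "integrable M w"
  shows "((\<lambda>a. \<integral>z. k a z \<partial>M) has_real_derivative (\<integral>z. k' a0 z \<partial>M)) (at a0)"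
  unfolding has_field_derivative_iff tendsto_at_iff_sequentially
proof (intro allI impI)
  fix X assume ne: "\<forall>n. X n \<in> UNIV - {a0}" and X: "X \<longlonglongrightarrow> a0"
  have "\<forall>\<^sub>F n in sequentially. \<bar>X n - a0\<bar> < d"
    using tendstoD[OF X d] by (simp add: dist_real_def)
  then obtain n0 where n0: "\<And>n. n \<ge> n0 \<Longrightarrow> \<bar>X n - a0\<bar> < d"
    unfolding eventually_sequentially by blast
  define D where "D n z = (k (X (n + n0)) z - k a0 z) / (X (n + n0) - a0)" for n z
  have a0: "\<bar>a0 - a0\<bar> < d"
    using d by simp
  have "(\<lambda>n. \<integral>z. D n z \<partial>M) \<longlonglongrightarrow> (\<integral>z. k' a0 z \<partial>M)"
  proof (rule integral_dominated_convergence)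
    show "D n \<in> borel_measurable M" for n
      unfolding D_def using int[OF n0[of "n + n0"]] int[OF a0] by (intro borel_measurable_integrable) auto
    show "AE z in M. (\<lambda>n. D n z) \<longlonglongrightarrow> k' a0 z"
    proof (rule AE_I2)
      fix z
      have "((\<lambda>y. (k y z - k a0 z) / (y - a0)) \<longlongrightarrow> k' a0 z) (at a0)"
        using deriv[OF a0] by (simp add: has_field_derivative_iff)
      then show "(\<lambda>n. D n z) \<longlonglongrightarrow> k' a0 z"
        unfolding D_def
        by (rule filterlim_compose)
          (use ne LIMSEQ_ignore_initial_segment[OF X, of n0] in \<open>auto simp: filterlim_at\<close>)
    qed
    show "AE z in M. norm (D n z) \<le> w z" for n
    proof (rule AE_I2)
      fix z
      have "norm (k (X (n + n0)) z - k a0 z) \<le> w z * norm (X (n + n0) - a0)"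
      proof (rule field_differentiable_bound[where S = "ball a0 d"])
        show "((\<lambda>a. k a z) has_field_derivative k' b z) (at b within ball a0 d)" if "b \<in> ball a0 d" for b
          using has_field_derivative_at_within[OF deriv[of b z]] that by (simp add: dist_real_def abs_minus_commute)
      qed (use d n0 bound in \<open>auto simp: dist_real_def abs_minus_commute\<close>)
      moreover have "norm (X (n + n0) - a0) > 0"
        using ne by simp
      ultimately show "norm (D n z) \<le> w z"
        by (simp add: D_def norm_divide field_simps)
    qed
  qed (use meas w in auto)
  moreover have "(\<integral>z. D n z \<partial>M) = ((\<integral>z. k (X (n + n0)) z \<partial>M) - (\<integral>z. k a0 z \<partial>M)) / (X (n + n0) - a0)" for n
  proof -
    have "integrable M (k (X (n + n0)))" "integrable M (k a0)"
      using n0[of "n + n0"] a0 by (auto intro: int)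
    then show ?thesis
      unfolding D_def by (subst integral_divide_zero) (simp add: Bochner_Integration.integral_diff)
  qed
  ultimately have "(\<lambda>n. ((\<integral>z. k (X (n + n0)) z \<partial>M) - (\<integral>z. k a0 z \<partial>M)) / (X (n + n0) - a0)) \<longlonglongrightarrow> (\<integral>z. k' a0 z \<partial>M)"
    by simp
  from LIMSEQ_offset[OF this]
  show "((\<lambda>y. ((\<integral>z. k y z \<partial>M) - (\<integral>z. k a0 z \<partial>M)) / (y - a0)) \<circ> X) \<longlonglongrightarrow> (\<integral>z. k' a0 z \<partial>M)"
    by (simp add: o_def)
qed

section \<open>The standard Gaussian measure\<close>

definition gauss_density :: "'a::euclidean_space \<Rightarrow> real" where
  "gauss_density z = (\<Prod>b\<in>Basis. std_normal_density (z \<bullet> b))"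

text \<open>The law of a standard normal vector Z. The average of h(x + r Z) is the heat semigroup
  at time r^2/2; keeping the measure fixed and the scale r in the argument makes r = 0 a regular
  value.\<close>

definition gauss :: "'a::euclidean_space measure" where
  "gauss = density lborel (\<lambda>z. ennreal (gauss_density z))"

lemma gauss_density_measurable [measurable]: "gauss_density \<in> borel_measurable borel"
  unfolding gauss_density_def by measurable

lemma gauss_density_nonneg [simp]: "gauss_density z \<ge> 0"
  by (simp add: gauss_density_def prod_nonneg)

lemma sets_gauss [measurable_cong, simp]: "sets gauss = sets borel"
  and space_gauss [simp]: "space gauss = UNIV"
  by (simp_all add: gauss_def)

text \<open>Two values of \<open>\<sigma>\<close> matter: 1 normalises \<open>gauss\<close>, and 2
  gives the integrability of exp(-|z|^2/8), the common majorant.\<close>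

lemma nn_integral_normal_density_prod:
  assumes "\<sigma> > 0"
  shows "(\<integral>\<^sup>+z. ennreal (\<Prod>b\<in>Basis. normal_density 0 \<sigma> (z \<bullet> b)) \<partial>(lborel :: 'a::euclidean_space measure)) = 1"
proof -
  have "(\<integral>\<^sup>+z. ennreal (\<Prod>b\<in>Basis. normal_density 0 \<sigma> (z \<bullet> b)) \<partial>(lborel :: 'a measure)) =
      (\<integral>\<^sup>+z. (\<Prod>b\<in>Basis. ennreal (normal_density 0 \<sigma> (z \<bullet> b))) \<partial>(lborel :: 'a measure))"
    by (simp add: prod_ennreal)
  also have "\<dots> = (\<Prod>b\<in>(Basis::'a set). \<integral>\<^sup>+x. ennreal (normal_density 0 \<sigma> x) \<partial>lborel)"
    by (rule nn_integral_lborel_prod) auto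
  also have "\<dots> = 1"
    using prob_space.emeasure_space_1[OF prob_space_normal_density[OF assms, of 0]]
    by (simp add: emeasure_density)
  finally show ?thesis .
qed

lemma normal_density_prod:
  "(\<Prod>b\<in>Basis. normal_density 0 \<sigma> (z \<bullet> b)) =
    (1 / sqrt (2 * pi * \<sigma>\<^sup>2)) ^ DIM('a) * exp (- (norm z)\<^sup>2 / (2 * \<sigma>\<^sup>2))" for z :: "'a::euclidean_space"
proof -
  have "(norm z)\<^sup>2 = (\<Sum>b\<in>Basis. (z \<bullet> b)\<^sup>2)"
    unfolding power2_norm_eq_inner by (subst euclidean_inner) (simp add: power2_eq_square)
  then have "exp (- (norm z)\<^sup>2 / (2 * \<sigma>\<^sup>2)) = (\<Prod>b\<in>Basis. exp (- (z \<bullet> b)\<^sup>2 / (2 * \<sigma>\<^sup>2)))"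
    by (simp add: exp_sum[symmetric] sum_divide_distrib sum_negf)
  then show ?thesis
    by (simp add: normal_density_def prod.distrib prod_dividef power_divide)
qed

lemma gauss_density_exp:
  "gauss_density z = (1 / sqrt (2 * pi)) ^ DIM('a) * exp (- (norm z)\<^sup>2 / 2)" for z :: "'a::euclidean_space"
  using normal_density_prod[of 1 z] by (simp add: gauss_density_def)

lemma integrable_exp_neg_norm_sq:
  "integrable lborel (\<lambda>z::'a::euclidean_space. exp (- (norm z)\<^sup>2 / 8))"
proof -
  have "integrable lborel (\<lambda>z::'a. \<Prod>b\<in>Basis. normal_density 0 2 (z \<bullet> b))"
    by (rule integrableI_nonneg) (auto simp: nn_integral_normal_density_prod prod_nonneg)
  then show ?thesis
    by (simp add: normal_density_prod)
qed

lemma prob_space_gauss: "prob_space (gauss :: 'a::euclidean_space measure)"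
  by (rule prob_spaceI)
    (use nn_integral_normal_density_prod[of 1] in \<open>simp add: gauss_def emeasure_density gauss_density_def\<close>)

interpretation gauss: prob_space "gauss :: 'a::euclidean_space measure"
  by (rule prob_space_gauss)

text \<open>A majorant for the differentiated kernel, uniform over shifts of length at most 1. With
  y = |z - v|, half of the exponent y^2/2 absorbs the factor y, since y <= exp(y^2/4); the other
  half is compared with |z|^2/8 through |z|^2 <= 2 y^2 + 2.\<close>

lemma gauss_density_shift_le:
  fixes z v :: "'a::euclidean_space"
  assumes "norm v \<le> 1"
  shows "gauss_density (z - v) * norm (z - v) \<le> (1 / sqrt (2 * pi)) ^ DIM('a) * exp (1/4) * exp (- (norm z)\<^sup>2 / 8)"
proof -
  let ?x = "norm (z - v)"
  have "norm z \<le> ?x + 1"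
    using norm_triangle_ineq[of "z - v" v] assms by simp
  then have "(norm z)\<^sup>2 \<le> (?x + 1)\<^sup>2"
    by (simp add: power_mono)
  also have "\<dots> \<le> 2 * ?x\<^sup>2 + 2"
    using sum_squares_ge_zero[of "?x - 1" 0] by (simp add: power2_eq_square algebra_simps)
  finally have *: "- (?x\<^sup>2 / 4) \<le> 1/4 + (- (norm z)\<^sup>2 / 8)"
    by simp
  have "0 \<le> (?x / 2 - 1)\<^sup>2"
    by simp
  then have "?x \<le> 1 + ?x\<^sup>2 / 4"
    by (simp add: power2_eq_square algebra_simps)
  also have "\<dots> \<le> exp (?x\<^sup>2 / 4)"
    by (rule exp_ge_add_one_self)
  finally have "exp (- ?x\<^sup>2 / 2) * ?x \<le> exp (- ?x\<^sup>2 / 2) * exp (?x\<^sup>2 / 4)"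
    by simp
  also have "\<dots> = exp (- (?x\<^sup>2 / 4))"
    by (simp add: exp_add[symmetric])
  also have "\<dots> \<le> exp (1/4 + (- (norm z)\<^sup>2 / 8))"
    using * by simp
  also have "\<dots> = exp (1/4) * exp (- (norm z)\<^sup>2 / 8)"
    by (rule exp_add)
  finally show ?thesis
    by (simp add: gauss_density_exp mult.assoc mult_left_mono)
qed

lemma integrable_gauss_norm: "integrable gauss (\<lambda>z::'a::euclidean_space. norm z)"
proof -
  have "integrable lborel (\<lambda>z::'a. gauss_density z * norm z)"
    by (rule Bochner_Integration.integrable_bound[OF integrable_mult_right[OF integrable_exp_neg_norm_sq,
            of "(1 / sqrt (2 * pi)) ^ DIM('a) * exp (1/4)"]])
      (use gauss_density_shift_le[of "0::'a"] in \<open>auto simp: abs_mult\<close>)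
  then show ?thesis
    by (simp add: gauss_def integrable_density)
qed

text \<open>Integration by parts against the Gaussian: the translation is moved from the merely continuous
  function onto the kernel.\<close>

lemma gauss_shift_derivative:
  fixes h :: "'a::euclidean_space \<Rightarrow> real" and e :: 'a
  assumes h: "continuous_on UNIV h" and B: "\<And>x. \<bar>h x\<bar> \<le> B" and r: "r > 0"
  shows "((\<lambda>a. \<integral>z. h (x + a *\<^sub>R e + r *\<^sub>R z) \<partial>gauss) has_real_derivative
    (\<integral>z. h (x + r *\<^sub>R z) * (z \<bullet> e) \<partial>gauss) / r) (at 0)"
proof -
  have [measurable]: "h \<in> borel_measurable borel"
    using h by (rule borel_measurable_continuous_onI)
  define k where "k a z = gauss_density (z - (a / r) *\<^sub>R e) * h (x + r *\<^sub>R z)" for a z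
  define k' where "k' a z = gauss_density (z - (a / r) *\<^sub>R e) * ((z - (a / r) *\<^sub>R e) \<bullet> e / r) * h (x + r *\<^sub>R z)" for a z
  have k: "(\<integral>z. h (x + a *\<^sub>R e + r *\<^sub>R z) \<partial>gauss) = (\<integral>z. k a z \<partial>lborel)" for a
  proof -
    have "(\<integral>z. k a z \<partial>lborel) = (\<integral>z. k a z \<partial>distr lborel borel ((+) ((a / r) *\<^sub>R e)))"
      by (simp add: lborel_distr_plus)
    also have "\<dots> = (\<integral>z. k a ((a / r) *\<^sub>R e + z) \<partial>lborel)"
      unfolding k_def by (subst integral_distr) auto
    also have "\<dots> = (\<integral>z. gauss_density z * h (x + a *\<^sub>R e + r *\<^sub>R z) \<partial>lborel)"
      using r by (simp add: k_def scaleR_add_right add.assoc)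
    finally show ?thesis
      unfolding gauss_def by (subst integral_density) auto
  qed
  \<comment> \<open>For |a| < \<open>d\<close> the shift \<open>(a / r) *\<^sub>R e\<close> has norm
    at most 1, the range of \<open>gauss_density_shift_le\<close>.\<close>
  define d where "d = r / (norm e + 1)"
  have d: "d > 0"
    using r by (simp add: d_def add_nonneg_pos)
  have small: "norm ((a / r) *\<^sub>R e) \<le> 1" if "\<bar>a - 0\<bar> < d" for a
  proof -
    have "\<bar>a\<bar> * (norm e + 1) \<le> r"
      using that by (simp add: d_def pos_less_divide_eq add_nonneg_pos)
    then have "\<bar>a\<bar> * norm e \<le> r"
      by (simp add: algebra_simps)
    then show ?thesis
      using r by (simp add: field_simps)
  qed
  have "((\<lambda>a. \<integral>z. k a z \<partial>lborel) has_real_derivative (\<integral>z. k' 0 z \<partial>lborel)) (at 0)"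
  proof (rule has_real_derivative_integral_dominated[OF d])
    show "k' 0 \<in> borel_measurable lborel"
      unfolding k'_def by measurable
    show "((\<lambda>a. k a z) has_real_derivative k' a z) (at a)" for a z
    proof -
      have sq: "(norm (z - (a / r) *\<^sub>R e))\<^sup>2 = (norm z)\<^sup>2 - 2 * (a / r) * (z \<bullet> e) + (a / r)\<^sup>2 * (norm e)\<^sup>2" for a
        unfolding power2_norm_eq_inner
        by (simp add: inner_diff_left inner_diff_right inner_commute[of e z] algebra_simps power2_eq_square[of "a / r"])
      show ?thesis
        unfolding k_def k'_def gauss_density_exp sq
        using r by (auto intro!: derivative_eq_intros simp: dot_square_norm inner_diff_left power2_eq_square field_simps)
    qed
    show "\<bar>k' a z\<bar> \<le> (1 / sqrt (2 * pi)) ^ DIM('a) * exp (1/4) * exp (- (norm z)\<^sup>2 / 8) * (norm e / r * B)"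
      if "\<bar>a - 0\<bar> < d" for a z
    proof -
      let ?y = "z - (a / r) *\<^sub>R e"
      have "\<bar>k' a z\<bar> = gauss_density ?y * (\<bar>?y \<bullet> e\<bar> / r) * \<bar>h (x + r *\<^sub>R z)\<bar>"
        using r by (simp add: k'_def abs_mult)
      also have "\<dots> \<le> gauss_density ?y * (norm ?y * norm e / r) * B"
        using r by (intro mult_mono mult_left_mono divide_right_mono B Cauchy_Schwarz_ineq2) auto
      also have "\<dots> = gauss_density ?y * norm ?y * (norm e / r * B)"
        by simp
      also have "\<dots> \<le> (1 / sqrt (2 * pi)) ^ DIM('a) * exp (1/4) * exp (- (norm z)\<^sup>2 / 8) * (norm e / r * B)"
        using r B[of x] by (intro mult_right_mono gauss_density_shift_le small that) auto
      finally show ?thesis .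
    qed
    show "integrable lborel (\<lambda>z::'a. (1 / sqrt (2 * pi)) ^ DIM('a) * exp (1/4) * exp (- (norm z)\<^sup>2 / 8) * (norm e / r * B))"
      by (intro integrable_mult_left integrable_mult_right integrable_exp_neg_norm_sq)
    show "integrable lborel (k a)" for a
    proof -
      have "integrable gauss (\<lambda>z. h (x + a *\<^sub>R e + r *\<^sub>R z))"
        by (rule gauss.integrable_const_bound[of _ B]) (use B in auto)
      then have "integrable lborel (\<lambda>z. gauss_density z * h (x + a *\<^sub>R e + r *\<^sub>R z))"
        unfolding gauss_def by (subst (asm) integrable_density) auto
      also have "(\<lambda>z. gauss_density z * h (x + a *\<^sub>R e + r *\<^sub>R z)) = (\<lambda>z. k a ((a / r) *\<^sub>R e + z))"
        using r by (auto simp: k_def fun_eq_iff scaleR_add_right add.assoc)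
      finally have "integrable (distr lborel borel ((+) ((a / r) *\<^sub>R e))) (k a)"
        unfolding k_def by (subst integrable_distr_eq) auto
      then show ?thesis
        by (simp add: lborel_distr_plus)
    qed
  qed
  moreover have "(\<integral>z. k' 0 z \<partial>lborel) = (\<integral>z. h (x + r *\<^sub>R z) * (z \<bullet> e) \<partial>gauss) / r"
  proof -
    have "(\<integral>z. k' 0 z \<partial>lborel) = (\<integral>z. gauss_density z * (h (x + r *\<^sub>R z) * (z \<bullet> e)) / r \<partial>lborel)"
      by (simp add: k'_def mult_ac)
    also have "\<dots> = (\<integral>z. gauss_density z * (h (x + r *\<^sub>R z) * (z \<bullet> e)) \<partial>lborel) / r"
      by (rule integral_divide_zero)
    finally show ?thesis
      unfolding gauss_def by (subst integral_density) auto
  qed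
  ultimately show ?thesis
    by (simp add: k)
qed

section \<open>A parabolic Leibniz rule\<close>

text \<open>The expression is the integral of \<open>p\<close> from 0 to R, rescaled to the fixed
  interval [0,1]. This form covers every sign of R and lets further parameters be handled by
  theorems about a fixed domain.\<close>

lemma scaled_integral_has_real_derivative:
  fixes p :: "real \<Rightarrow> real"
  assumes p: "continuous_on UNIV p"
  shows "((\<lambda>R. R * integral {0..1} (\<lambda>\<theta>. p (R * \<theta>))) has_real_derivative p R) (at R)"
proof -
  obtain P where P: "\<And>x. (P has_real_derivative p x) (at x)"
    using continuous_antiderivative[OF p] by blast
  have "R * integral {0..1} (\<lambda>\<theta>. p (R * \<theta>)) = P R - P 0" for R
  proof -
    have "((\<lambda>\<theta>. p (R * \<theta>) * R) has_integral P (R * 1) - P (R * 0)) {0..1}"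
    proof (rule fundamental_theorem_of_calculus)
      fix \<theta>
      have "((\<lambda>\<theta>. P (R * \<theta>)) has_real_derivative p (R * \<theta>) * R) (at \<theta>)"
        by (rule DERIV_chain2[OF P]) (auto intro!: derivative_eq_intros)
      then show "((\<lambda>\<theta>. P (R * \<theta>)) has_vector_derivative p (R * \<theta>) * R) (at \<theta> within {0..1})"
        unfolding has_real_derivative_iff_has_vector_derivative by (rule has_vector_derivative_at_within)
    qed simp
    from integral_unique[OF this] show ?thesis
      by (simp add: mult.commute)
  qed
  then show ?thesis
    using DERIV_diff[OF P DERIV_const] by simp
qed

lemma continuous_on_curried:
  assumes "continuous_on UNIV (\<lambda>(x, y). h x y)" "continuous_on S f" "continuous_on S g"
  shows "continuous_on S (\<lambda>z. h (f z) (g z))"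
  using continuous_on_compose2[OF assms(1) continuous_on_Pair[OF assms(2,3)]] by simp

text \<open>Existence of both partial derivatives together with joint continuity of one of them
  already gives total differentiability; hence the asymmetric hypotheses.\<close>

lemma has_real_derivative_chain2:
  fixes G G1 G2 :: "real \<Rightarrow> real \<Rightarrow> real"
  assumes G1: "\<And>x y. ((\<lambda>x. G x y) has_real_derivative G1 x y) (at x)"
    and G2: "\<And>x y. ((\<lambda>y. G x y) has_real_derivative G2 x y) (at y)"
    and cont: "continuous_on UNIV (\<lambda>(x, y). G2 x y)"
    and a: "(a has_real_derivative a') (at t)" and b: "(b has_real_derivative b') (at t)"
  shows "((\<lambda>t. G (a t) (b t)) has_real_derivative G1 (a t) (b t) * a' + G2 (a t) (b t) * b') (at t)"
proof -
  have "((\<lambda>(x, y). G x y) has_derivative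
      (\<lambda>(tx, ty). G1 (a t) (b t) * tx + blinfun_mult_right (G2 (a t) (b t)) ty)) (at (a t, b t) within UNIV \<times> UNIV)"
  proof (rule has_derivative_partialsI)
    show "((\<lambda>x. G x (b t)) has_derivative (*) (G1 (a t) (b t))) (at (a t) within UNIV)"
      using G1 by (simp add: has_field_derivative_def)
    show "((\<lambda>y. G x y) has_derivative blinfun_apply (blinfun_mult_right (G2 x y))) (at y within UNIV)" for x y
      using G2 by (simp add: has_field_derivative_def)
    have "continuous_on UNIV (\<lambda>(x, y). blinfun_mult_right (G2 x y))"
      using cont unfolding split_beta by (intro continuous_intros)
    then show "continuous (at (a t, b t) within UNIV \<times> UNIV) (\<lambda>(x, y). blinfun_mult_right (G2 x y))"
      by (simp add: continuous_on_eq_continuous_at)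
  qed auto
  then have "((\<lambda>(x, y). G x y) has_derivative
      (\<lambda>(tx, ty). G1 (a t) (b t) * tx + G2 (a t) (b t) * ty)) (at (a t, b t))"
    by simp
  moreover have "((\<lambda>t. (a t, b t)) has_derivative (\<lambda>h. (a' * h, b' * h))) (at t)"
    using a b by (auto simp: has_field_derivative_def intro!: has_derivative_Pair)
  ultimately have "((\<lambda>t. (\<lambda>(x, y). G x y) (a t, b t)) has_derivative
      (\<lambda>h. (\<lambda>(tx, ty). G1 (a t) (b t) * tx + G2 (a t) (b t) * ty) (a' * h, b' * h))) (at t)"
    using has_derivative_compose by fastforce
  moreover have "(\<lambda>h. (\<lambda>(tx, ty). G1 (a t) (b t) * tx + G2 (a t) (b t) * ty) (a' * h, b' * h)) =
      (*) (G1 (a t) (b t) * a' + G2 (a t) (b t) * b')"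
    by (auto simp: fun_eq_iff algebra_simps)
  ultimately show ?thesis
    by (simp add: has_field_derivative_def)
qed

text \<open>Formally \<open>r * \<partial>\<^sub>s h (r, t - r\<^sup>2/2) = \<partial>\<^sub>r h - d/dr (h (r, t - r\<^sup>2/2))\<close>, which trades the missing
  time derivative of \<open>h\<close> for a radial one. Since \<open>h\<close> is not differentiable in \<open>s\<close>, the argument is
  carried out for its primitive \<open>B\<close> in \<open>s\<close>.\<close>

lemma parabolic_leibniz:
  fixes h \<Phi> :: "real \<Rightarrow> real \<Rightarrow> real"
  assumes h: "continuous_on UNIV (\<lambda>(r, s). h r s)"
    and \<Phi>: "continuous_on UNIV (\<lambda>(r, s). \<Phi> r s)"
    and deriv: "\<And>r s. ((\<lambda>r. h r s) has_real_derivative \<Phi> r s) (at r)"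
    and t: "t > 0"
  shows "((\<lambda>t. 2 * t * integral {0..1} (\<lambda>\<rho>. \<rho> * h (sqrt (2 * t) * \<rho>) (t * (1 - \<rho>\<^sup>2)))) has_real_derivative
    h 0 t + sqrt (2 * t) * integral {0..1} (\<lambda>\<rho>. \<Phi> (sqrt (2 * t) * \<rho>) (t * (1 - \<rho>\<^sup>2)))) (at t)"
proof -
  note [continuous_intros] = continuous_on_curried[OF h] continuous_on_curried[OF \<Phi>]
  \<comment> \<open>\<open>B\<close> and \<open>\<Psi>\<close> are the primitives in s, starting at
    s = 0, of \<open>h\<close> and \<open>\<Phi>\<close>; \<open>D R t\<close> integrates
    \<open>\<Psi>\<close> over r from 0 to R along the parabola s = t - r^2/2.\<close>
  define B where "B r s = s * integral {0..1} (\<lambda>\<theta>. h r (s * \<theta>))" for r s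
  define \<Psi> where "\<Psi> r s = s * integral {0..1} (\<lambda>\<theta>. \<Phi> r (s * \<theta>))" for r s
  define D where "D R t = R * integral {0..1} (\<lambda>\<rho>. \<Psi> (R * \<rho>) (t - (R * \<rho>)\<^sup>2 / 2))" for R t
  have \<Psi>: "continuous_on UNIV (\<lambda>(r, s). \<Psi> r s)"
  proof -
    have "continuous_on UNIV (\<lambda>p. integral (cbox 0 1) (\<lambda>\<theta>. \<Phi> (fst p) (snd p * \<theta>)))"
      by (rule integral_continuous_on_param) (auto simp: split_beta intro!: continuous_intros)
    then show ?thesis
      unfolding \<Psi>_def split_beta by (auto intro!: continuous_intros)
  qed
  note [continuous_intros] = continuous_on_curried[OF \<Psi>]
  have B_s: "((\<lambda>s. B r s) has_real_derivative h r s) (at s)" for r s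
    unfolding B_def by (rule scaled_integral_has_real_derivative) (auto intro!: continuous_intros)
  have \<Psi>_s: "((\<lambda>s. \<Psi> r s) has_real_derivative \<Phi> r s) (at s)" for r s
    unfolding \<Psi>_def by (rule scaled_integral_has_real_derivative) (auto intro!: continuous_intros)
  have B_r: "((\<lambda>r. B r s) has_real_derivative \<Psi> r s) (at r)" for r s
  proof -
    have "((\<lambda>r. integral (cbox 0 1) (\<lambda>\<theta>. h r (s * \<theta>))) has_real_derivative
        integral (cbox 0 1) (\<lambda>\<theta>. \<Phi> r (s * \<theta>))) (at r within UNIV)"
      by (rule leibniz_rule_field_derivative)
        (auto simp: split_beta intro!: continuous_intros integrable_continuous_real deriv)
    then show ?thesis
      unfolding B_def \<Psi>_def by (auto intro!: derivative_eq_intros)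
  qed
  have D_R: "((\<lambda>R. D R t) has_real_derivative \<Psi> R (t - R\<^sup>2 / 2)) (at R)" for R t
    unfolding D_def
    by (rule scaled_integral_has_real_derivative[where p = "\<lambda>x. \<Psi> x (t - x\<^sup>2 / 2)"])
      (auto intro!: continuous_intros)
  have D_t: "((\<lambda>t. D R t) has_real_derivative R * integral {0..1} (\<lambda>\<rho>. \<Phi> (R * \<rho>) (t - (R * \<rho>)\<^sup>2 / 2))) (at t)" for R t
  proof -
    have "((\<lambda>t. integral (cbox 0 1) (\<lambda>\<rho>. \<Psi> (R * \<rho>) (t - (R * \<rho>)\<^sup>2 / 2))) has_real_derivative
        integral (cbox 0 1) (\<lambda>\<rho>. \<Phi> (R * \<rho>) (t - (R * \<rho>)\<^sup>2 / 2))) (at t within UNIV)"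
    proof (rule leibniz_rule_field_derivative)
      show "((\<lambda>t. \<Psi> (R * \<rho>) (t - (R * \<rho>)\<^sup>2 / 2)) has_real_derivative \<Phi> (R * \<rho>) (t - (R * \<rho>)\<^sup>2 / 2)) (at t within UNIV)"
        for t \<rho>
      proof -
        have "((\<lambda>t. t - (R * \<rho>)\<^sup>2 / 2) has_real_derivative 1) (at t)"
          by (auto intro!: derivative_eq_intros)
        from DERIV_chain2[OF \<Psi>_s this] show ?thesis
          by simp
      qed
    qed (auto simp: split_beta intro!: continuous_intros integrable_continuous_real)
    then show ?thesis
      unfolding D_def by (auto intro!: derivative_eq_intros)
  qed
  have D_t_cont: "continuous_on UNIV (\<lambda>(R, t). R * integral {0..1} (\<lambda>\<rho>. \<Phi> (R * \<rho>) (t - (R * \<rho>)\<^sup>2 / 2)))"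
  proof -
    have "continuous_on UNIV (\<lambda>p. integral (cbox 0 1) (\<lambda>\<rho>. \<Phi> (fst p * \<rho>) (snd p - (fst p * \<rho>)\<^sup>2 / 2)))"
      by (rule integral_continuous_on_param) (auto simp: split_beta intro!: continuous_intros)
    then show ?thesis
      unfolding split_beta by (auto intro!: continuous_intros)
  qed
  \<comment> \<open>Integrated form of the parabolic identity: along the parabola B(R, t - R^2/2)
    has R-derivative \<open>\<Psi>\<close> - R h, so both sides have derivative R h and agree at R =
    0.\<close>
  have identity: "R * integral {0..1} (\<lambda>\<rho>. (R * \<rho>) * h (R * \<rho>) (t - (R * \<rho>)\<^sup>2 / 2)) =
      B 0 t - B R (t - R\<^sup>2 / 2) + D R t" for R t
  proof -
    let ?E = "\<lambda>R. R * integral {0..1} (\<lambda>\<rho>. (R * \<rho>) * h (R * \<rho>) (t - (R * \<rho>)\<^sup>2 / 2)) -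
      (B 0 t - B R (t - R\<^sup>2 / 2) + D R t)"
    have "(?E has_real_derivative 0) (at R)" for R
    proof -
      have 1: "((\<lambda>R. R * integral {0..1} (\<lambda>\<rho>. (R * \<rho>) * h (R * \<rho>) (t - (R * \<rho>)\<^sup>2 / 2))) has_real_derivative
          R * h R (t - R\<^sup>2 / 2)) (at R)"
        by (rule scaled_integral_has_real_derivative[where p = "\<lambda>x. x * h x (t - x\<^sup>2 / 2)"])
          (auto intro!: continuous_intros)
      have 2: "((\<lambda>R. B R (t - R\<^sup>2 / 2)) has_real_derivative
          \<Psi> R (t - R\<^sup>2 / 2) * 1 + h R (t - R\<^sup>2 / 2) * (- R)) (at R)"
        by (rule has_real_derivative_chain2[OF B_r B_s h]) (auto intro!: derivative_eq_intros)
      show ?thesis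
        using DERIV_diff[OF 1 DERIV_add[OF DERIV_diff[OF DERIV_const[of "B 0 t"] 2] D_R[of t R]]] by simp
    qed
    then have "?E R = ?E 0"
      using DERIV_isconst_all by blast
    then show ?thesis
      by (simp add: D_def)
  qed
  have V: "2 * \<tau> * integral {0..1} (\<lambda>\<rho>. \<rho> * h (sqrt (2 * \<tau>) * \<rho>) (\<tau> * (1 - \<rho>\<^sup>2))) = B 0 \<tau> + D (sqrt (2 * \<tau>)) \<tau>"
    if "\<tau> > 0" for \<tau>
  proof -
    let ?R = "sqrt (2 * \<tau>)"
    have R: "?R * ?R = 2 * \<tau>"
      using that by simp
    have "2 * \<tau> * integral {0..1} (\<lambda>\<rho>. \<rho> * h (?R * \<rho>) (\<tau> * (1 - \<rho>\<^sup>2))) =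
        ?R * integral {0..1} (\<lambda>\<rho>. (?R * \<rho>) * h (?R * \<rho>) (\<tau> - (?R * \<rho>)\<^sup>2 / 2))"
    proof -
      have "\<tau> - (?R * \<rho>)\<^sup>2 / 2 = \<tau> * (1 - \<rho>\<^sup>2)" for \<rho>
        using that by (simp add: power_mult_distrib algebra_simps)
      then have "(\<lambda>\<rho>. (?R * \<rho>) * h (?R * \<rho>) (\<tau> - (?R * \<rho>)\<^sup>2 / 2)) = (\<lambda>\<rho>. ?R * (\<rho> * h (?R * \<rho>) (\<tau> * (1 - \<rho>\<^sup>2))))"
        by (simp only: mult.assoc)
      then show ?thesis
        by (simp only: integral_mult_right) (simp only: mult.assoc[symmetric] R)
    qed
    also have "\<dots> = B 0 \<tau> - B ?R 0 + D ?R \<tau>"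
      unfolding identity using that by simp
    also have "B ?R 0 = 0"
      by (simp add: B_def)
    finally show ?thesis
      by simp
  qed
  have "((\<lambda>t. B 0 t + D (sqrt (2 * t)) t) has_real_derivative
      h 0 t + (\<Psi> (sqrt (2 * t)) (t - (sqrt (2 * t))\<^sup>2 / 2) * (1 / sqrt (2 * t)) +
        sqrt (2 * t) * integral {0..1} (\<lambda>\<rho>. \<Phi> (sqrt (2 * t) * \<rho>) (t - (sqrt (2 * t) * \<rho>)\<^sup>2 / 2)) * 1)) (at t)"
    using t
    by (intro DERIV_add B_s has_real_derivative_chain2[OF D_R D_t D_t_cont])
      (auto intro!: derivative_eq_intros simp: field_simps)
  \<comment> \<open>The moving endpoint R = sqrt(2t) contributes nothing: there the parabola reaches
    s = 0, where the primitive \<open>\<Psi>\<close> vanishes.\<close>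
  moreover have "\<Psi> (sqrt (2 * t)) (t - (sqrt (2 * t))\<^sup>2 / 2) = 0"
    using t by (simp add: \<Psi>_def)
  moreover have "t - (sqrt (2 * t) * \<rho>)\<^sup>2 / 2 = t * (1 - \<rho>\<^sup>2)" for \<rho>
    using t by (simp add: power_mult_distrib algebra_simps)
  ultimately have "((\<lambda>t. B 0 t + D (sqrt (2 * t)) t) has_real_derivative
      h 0 t + sqrt (2 * t) * integral {0..1} (\<lambda>\<rho>. \<Phi> (sqrt (2 * t) * \<rho>) (t * (1 - \<rho>\<^sup>2)))) (at t)"
    by simp
  then show ?thesis
    by (rule has_field_derivative_transform_within_open[where S = "{0<..}"]) (use t V in auto)
qed

section \<open>The Duhamel integral\<close>

lemma gauss_UNIV [simp]: "measure (gauss :: 'a::euclidean_space measure) UNIV = 1"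
  using gauss.prob_space by simp

text \<open>Time runs over the whole line, so continuity is a statement on \<open>UNIV\<close>
  without a boundary at t = 0; data given for t >= 0 are frozen at their value at 0 for earlier
  times (\<open>max t 0\<close>). Bounds may grow with T, as global solutions can.\<close>

definition tame :: "('a::euclidean_space \<Rightarrow> real \<Rightarrow> 'b::real_normed_vector) \<Rightarrow> bool" where
  "tame h \<longleftrightarrow> continuous_on UNIV (\<lambda>(x, s). h x s) \<and> (\<forall>T. \<exists>C. \<forall>x. \<forall>s\<le>T. norm (h x s) \<le> C)"

definition avg :: "('a::euclidean_space \<Rightarrow> real \<Rightarrow> real) \<Rightarrow> real \<Rightarrow> 'a \<Rightarrow> real \<Rightarrow> real" where
  "avg h r x s = (\<integral>z. h (x + r *\<^sub>R z) s \<partial>gauss)"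

text \<open>The first Gaussian moment. For r > 0, \<open>avgz h r x s\<close> divided by r is the
  spatial gradient of \<open>avg h r x s\<close>.\<close>

definition avgz :: "('a::euclidean_space \<Rightarrow> real \<Rightarrow> real) \<Rightarrow> real \<Rightarrow> 'a \<Rightarrow> real \<Rightarrow> 'a" where
  "avgz h r x s = (\<integral>z. h (x + r *\<^sub>R z) s *\<^sub>R z \<partial>gauss)"

text \<open>With \<open>Z\<close> standard normal, this is \<open>\<integral>\<^sub>0\<^sup>t E (h (x + sqrt (2 (t - s)) Z) s) ds\<close> after the substitution
  \<open>s = t (1 - \<rho>\<^sup>2)\<close>, which removes the singularity of the spatial derivative at \<open>s = t\<close>.\<close>

definition duhamel :: "('a::euclidean_space \<Rightarrow> real \<Rightarrow> real) \<Rightarrow> 'a \<Rightarrow> real \<Rightarrow> real" where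
  "duhamel h x t = 2 * t * integral {0..1} (\<lambda>\<rho>. \<rho> * avg h (sqrt (2 * t) * \<rho>) x (t * (1 - \<rho>\<^sup>2)))"

text \<open>The spatial gradient of \<open>duhamel h\<close>: differentiating the average costs
  1/(sqrt(2t) \<open>\<rho>\<close>), which the weight \<open>\<rho>\<close> and the factor 2t
  reduce to the single factor sqrt(2t).\<close>

definition duhamelz :: "('a::euclidean_space \<Rightarrow> real \<Rightarrow> real) \<Rightarrow> 'a \<Rightarrow> real \<Rightarrow> 'a" where
  "duhamelz h x t = sqrt (2 * t) *\<^sub>R integral {0..1} (\<lambda>\<rho>. avgz h (sqrt (2 * t) * \<rho>) x (t * (1 - \<rho>\<^sup>2)))"

lemma tame_cont: "tame h \<Longrightarrow> continuous_on UNIV (\<lambda>(x, s). h x s)"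
  by (simp add: tame_def)

lemma tame_bound:
  assumes "tame h"
  obtains C where "C \<ge> 0" "\<And>x s. s \<le> T \<Longrightarrow> norm (h x s) \<le> C"
proof -
  obtain C where C: "\<And>x s. s \<le> T \<Longrightarrow> norm (h x s) \<le> C"
    using assms unfolding tame_def by meson
  show ?thesis
    using that[of C] C[of T undefined] C norm_ge_zero order_trans by blast
qed

lemma tame_continuous_on:
  "tame h \<Longrightarrow> continuous_on S f \<Longrightarrow> continuous_on S g \<Longrightarrow> continuous_on S (\<lambda>z. h (f z) (g z))"
  by (rule continuous_on_curried[OF tame_cont])

lemma tame_slice: "tame h \<Longrightarrow> continuous_on UNIV (\<lambda>x. h x s)"
  by (rule tame_continuous_on) (auto intro: continuous_intros)

lemma tame_measurable [measurable_dest]: "tame h \<Longrightarrow> (\<lambda>x. h x s) \<in> borel_measurable borel"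
  by (rule borel_measurable_continuous_onI[OF tame_slice])

lemma tame_inner: "tame k \<Longrightarrow> tame (\<lambda>x s. k x s \<bullet> e)"
  unfolding tame_def
proof (intro conjI allI)
  fix T
  assume k: "continuous_on UNIV (\<lambda>(x, s). k x s) \<and> (\<forall>T. \<exists>C. \<forall>x. \<forall>s\<le>T. norm (k x s) \<le> C)"
  then show "continuous_on UNIV (\<lambda>(x, s). k x s \<bullet> e)"
    by (auto simp: split_beta intro!: continuous_intros)
  from k obtain C where C: "\<forall>x. \<forall>s\<le>T. norm (k x s) \<le> C"
    by blast
  then have "\<forall>x. \<forall>s\<le>T. norm (k x s \<bullet> e) \<le> C * norm e"
    by (metis Cauchy_Schwarz_ineq2 mult_right_mono norm_ge_zero order_trans real_norm_def)
  then show "\<exists>C. \<forall>x. \<forall>s\<le>T. norm (k x s \<bullet> e) \<le> C"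
    by blast
qed

lemma tame_compose:
  fixes g :: "real \<Rightarrow> real"
  assumes h: "tame h" and g: "continuous_on UNIV g"
  shows "tame (\<lambda>x s. g (h x s))"
  unfolding tame_def
proof (intro conjI allI)
  fix T
  show "continuous_on UNIV (\<lambda>(x, s). g (h x s))"
    using continuous_on_compose2[OF g tame_cont[OF h]] by (simp add: split_beta)
  obtain C where C: "\<And>x s. s \<le> T \<Longrightarrow> norm (h x s) \<le> C"
    using tame_bound[OF h] by metis
  have "bounded (g ` {-C..C})"
    by (intro compact_imp_bounded compact_continuous_image continuous_on_subset[OF g]) auto
  then obtain D where "\<And>y. y \<in> {-C..C} \<Longrightarrow> norm (g y) \<le> D"
    unfolding bounded_iff by blast
  then have D: "norm (g y) \<le> D" if "y \<in> {-C..C}" for y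
    using that by blast
  have "\<forall>x. \<forall>s\<le>T. norm (g (h x s)) \<le> D"
  proof (intro allI impI)
    fix x s assume "s \<le> T"
    then have "h x s \<in> {-C..C}"
      using C[of s x] by (auto simp: abs_le_iff)
    then show "norm (g (h x s)) \<le> D"
      by (rule D)
  qed
  then show "\<exists>C. \<forall>x. \<forall>s\<le>T. norm (g (h x s)) \<le> C"
    by blast
qed

lemma tame_scaleR:
  fixes k :: "'a::euclidean_space \<Rightarrow> real \<Rightarrow> 'b::real_normed_vector"
  assumes g: "tame g" and k: "tame k"
  shows "tame (\<lambda>x s. g x s *\<^sub>R k x s)"
  unfolding tame_def
proof (intro conjI allI)
  fix T
  show "continuous_on UNIV (\<lambda>(x, s). g x s *\<^sub>R k x s)"
    using tame_cont[OF g] tame_cont[OF k] by (auto simp: split_beta intro!: continuous_intros)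
  obtain C where C: "C \<ge> 0" "\<And>x s. s \<le> T \<Longrightarrow> norm (g x s) \<le> C"
    using tame_bound[OF g] by metis
  obtain D where D: "\<And>x s. s \<le> T \<Longrightarrow> norm (k x s) \<le> D"
    using tame_bound[OF k] by metis
  have "\<forall>x. \<forall>s\<le>T. norm (g x s *\<^sub>R k x s) \<le> C * D"
    using C D by (auto intro!: mult_mono)
  then show "\<exists>C. \<forall>x. \<forall>s\<le>T. norm (g x s *\<^sub>R k x s) \<le> C"
    by blast
qed

lemma tame_add:
  assumes g: "tame g" and k: "tame k"
  shows "tame (\<lambda>x s. g x s + k x s)"
  unfolding tame_def
proof (intro conjI allI)
  fix T
  show "continuous_on UNIV (\<lambda>(x, s). g x s + k x s)"
    using tame_cont[OF g] tame_cont[OF k] by (auto simp: split_beta intro!: continuous_intros)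
  obtain C where C: "\<And>x s. s \<le> T \<Longrightarrow> norm (g x s) \<le> C"
    using tame_bound[OF g] by metis
  obtain D where D: "\<And>x s. s \<le> T \<Longrightarrow> norm (k x s) \<le> D"
    using tame_bound[OF k] by metis
  have "\<forall>x. \<forall>s\<le>T. norm (g x s + k x s) \<le> C + D"
    using C D by (auto intro!: norm_triangle_mono)
  then show "\<exists>C. \<forall>x. \<forall>s\<le>T. norm (g x s + k x s) \<le> C"
    by blast
qed

lemma tame_const_time:
  assumes "continuous_on UNIV u0" "\<And>x. norm (u0 x) \<le> C"
  shows "tame (\<lambda>x _. u0 x)"
  unfolding tame_def using assms
  by (auto simp: split_beta intro!: continuous_on_compose2[OF assms(1)] continuous_intros)

lemma tame_clamp:
  assumes cont: "continuous_on UNIV (\<lambda>(x, t). h x t)"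
    and bound: "\<And>T. T \<ge> 0 \<Longrightarrow> \<exists>C. \<forall>x. \<forall>t\<in>{0..T}. norm (h x t) \<le> C"
  shows "tame (\<lambda>x t. h x (max t 0))"
  unfolding tame_def
proof (intro conjI allI)
  fix T :: real
  show "continuous_on UNIV (\<lambda>(x, t). h x (max t 0))"
    unfolding split_beta by (intro continuous_on_curried[OF cont] continuous_intros)
  obtain C where C: "\<forall>x. \<forall>t\<in>{0..max T 0}. norm (h x t) \<le> C"
    using bound[of "max T 0"] by auto
  then have "\<forall>x. \<forall>s\<le>T. norm (h x (max s 0)) \<le> C"
    by auto
  then show "\<exists>C. \<forall>x. \<forall>s\<le>T. norm (h x (max s 0)) \<le> C"
    by blast
qed

section \<open>Bounds, continuity and derivatives of Gaussian averages\<close>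

lemma avg_integrable:
  assumes h: "tame h"
  shows "integrable gauss (\<lambda>z. h (x + r *\<^sub>R z) s :: real)"
proof -
  note [measurable] = tame_measurable[OF h]
  obtain C where "\<And>x. norm (h x s) \<le> C"
    using tame_bound[OF h, of s] by (metis order_refl)
  then show ?thesis
    by (intro gauss.integrable_const_bound[of _ C]) auto
qed

lemma avgz_integrable:
  assumes h: "tame h"
  shows "integrable gauss (\<lambda>z. h (x + r *\<^sub>R z) s *\<^sub>R z)"
proof -
  note [measurable] = tame_measurable[OF h]
  obtain C where "\<And>x. norm (h x s) \<le> C" and "C \<ge> 0"
    using tame_bound[OF h, of s] by (metis order_refl)
  then show ?thesis
    by (intro Bochner_Integration.integrable_bound[OF integrable_mult_right[OF integrable_gauss_norm, of C]])
      (auto simp: abs_mult intro!: mult_right_mono)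
qed

lemma avg_bound:
  assumes h: "tame h" and B: "\<And>x. \<bar>h x s\<bar> \<le> B"
  shows "\<bar>avg h r x s\<bar> \<le> B"
proof -
  have "\<bar>avg h r x s\<bar> \<le> (\<integral>z. \<bar>h (x + r *\<^sub>R z) s\<bar> \<partial>gauss)"
    unfolding avg_def by (rule integral_abs_bound)
  also have "\<dots> \<le> (\<integral>z. B \<partial>(gauss :: 'a measure))"
    by (intro integral_mono integrable_abs avg_integrable[OF h] B) auto
  also have "\<dots> = B"
    using gauss.prob_space by simp
  finally show ?thesis .
qed

lemma avgz_bound:
  fixes h :: "'a::euclidean_space \<Rightarrow> real \<Rightarrow> real"
  assumes h: "tame h" and B: "\<And>x. \<bar>h x s\<bar> \<le> B"
  shows "norm (avgz h r x s) \<le> B * (\<integral>z. norm z \<partial>(gauss :: 'a measure))"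
proof -
  have "norm (avgz h r x s) \<le> (\<integral>z. norm (h (x + r *\<^sub>R z) s *\<^sub>R z) \<partial>gauss)"
    unfolding avgz_def by (rule integral_norm_bound)
  also have "\<dots> \<le> (\<integral>z. B * norm z \<partial>(gauss :: 'a measure))"
    by (intro integral_mono integrable_norm avgz_integrable[OF h] integrable_mult_right integrable_gauss_norm)
      (auto intro!: mult_right_mono B)
  finally show ?thesis
    by simp
qed

lemma avg_zero [simp]: "avg h 0 x s = h x s"
  by (simp add: avg_def)

lemma avg_continuous:
  assumes h: "tame h"
  shows "continuous_on UNIV (\<lambda>p. avg h (fst p) (fst (snd p)) (snd (snd p)))"
  unfolding continuous_on_eq_continuous_at[OF open_UNIV] avg_def
proof (intro ballI)
  fix p0 :: "real \<times> 'a \<times> real"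
  note [measurable] = tame_measurable[OF h]
  obtain C where C: "\<And>x s. s \<le> snd (snd p0) + 1 \<Longrightarrow> norm (h x s) \<le> C"
    using tame_bound[OF h] by metis
  show "isCont (\<lambda>p. \<integral>z. h (fst (snd p) + fst p *\<^sub>R z) (snd (snd p)) \<partial>gauss) p0"
  proof (rule isCont_integral_dominated[where U = "{p. snd (snd p) < snd (snd p0) + 1}" and w = "\<lambda>_. C"])
    show "isCont (\<lambda>p. h (fst (snd p) + fst p *\<^sub>R z) (snd (snd p))) p0" for z
      by (rule continuous_on_interior[of UNIV])
        (auto intro!: tame_continuous_on[OF h] continuous_intros)
    show "open {p. snd (snd p) < snd (snd p0) + 1}"
      by (intro open_Collect_less continuous_intros)
  qed (use C in auto)
qed

lemma avgz_continuous:
  assumes h: "tame h"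
  shows "continuous_on UNIV (\<lambda>p. avgz h (fst p) (fst (snd p)) (snd (snd p)))"
  unfolding continuous_on_eq_continuous_at[OF open_UNIV] avgz_def
proof (intro ballI)
  fix p0 :: "real \<times> 'a \<times> real"
  note [measurable] = tame_measurable[OF h]
  obtain C where C: "\<And>x s. s \<le> snd (snd p0) + 1 \<Longrightarrow> norm (h x s) \<le> C"
    using tame_bound[OF h] by metis
  show "isCont (\<lambda>p. \<integral>z. h (fst (snd p) + fst p *\<^sub>R z) (snd (snd p)) *\<^sub>R z \<partial>gauss) p0"
  proof (rule isCont_integral_dominated[where U = "{p. snd (snd p) < snd (snd p0) + 1}" and w = "\<lambda>z. C * norm z"])
    show "isCont (\<lambda>p. h (fst (snd p) + fst p *\<^sub>R z) (snd (snd p)) *\<^sub>R z) p0" for z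
      by (rule continuous_on_interior[of UNIV])
        (auto intro!: tame_continuous_on[OF h] continuous_intros)
    show "open {p. snd (snd p) < snd (snd p0) + 1}"
      by (intro open_Collect_less continuous_intros)
    show "norm (h (fst (snd p) + fst p *\<^sub>R z) (snd (snd p)) *\<^sub>R z) \<le> C * norm z"
      if "p \<in> {p. snd (snd p) < snd (snd p0) + 1}" for p z
      using that C by (auto intro!: mult_right_mono)
    show "integrable gauss (\<lambda>z::'a. C * norm z)"
      by (intro integrable_mult_right integrable_gauss_norm)
  qed auto
qed

lemma avg_continuous_on:
  assumes "tame h" "continuous_on S f" "continuous_on S g" "continuous_on S k"
  shows "continuous_on S (\<lambda>z. avg h (f z) (g z) (k z))"
  using continuous_on_compose2[OF avg_continuous[OF assms(1)] continuous_on_Pair[OF assms(2) continuous_on_Pair[OF assms(3,4)]]]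
  by simp

lemma avgz_continuous_on:
  assumes "tame h" "continuous_on S f" "continuous_on S g" "continuous_on S k"
  shows "continuous_on S (\<lambda>z. avgz h (f z) (g z) (k z))"
  using continuous_on_compose2[OF avgz_continuous[OF assms(1)] continuous_on_Pair[OF assms(2) continuous_on_Pair[OF assms(3,4)]]]
  by simp

lemma avgz_inner:
  assumes h: "tame h"
  shows "avgz h r x s \<bullet> e = (\<integral>z. h (x + r *\<^sub>R z) s * (z \<bullet> e) \<partial>gauss)"
  unfolding avgz_def
  by (subst integral_inner_left[symmetric]) (auto intro: avgz_integrable h)

lemma has_real_derivative_line:
  fixes F :: "'a::real_vector \<Rightarrow> real"
  assumes "\<And>x. ((\<lambda>a. F (x + a *\<^sub>R e)) has_real_derivative G x) (at 0)"
  shows "((\<lambda>a. F (x + a *\<^sub>R e)) has_real_derivative G (x + a *\<^sub>R e)) (at a)"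
proof -
  have "((\<lambda>b. F (x + a *\<^sub>R e + b *\<^sub>R e)) has_real_derivative G (x + a *\<^sub>R e)) (at 0)"
    by (rule assms)
  then have "((\<lambda>b. F (x + (b + a) *\<^sub>R e)) has_real_derivative G (x + a *\<^sub>R e)) (at 0)"
    by (simp add: algebra_simps)
  then show ?thesis
    using DERIV_shift[of "\<lambda>b. F (x + b *\<^sub>R e)" "G (x + a *\<^sub>R e)" 0 a] by simp
qed

lemma avg_shift_derivative:
  assumes h: "tame h" and r: "r > 0"
  shows "((\<lambda>a. avg h r (x + a *\<^sub>R e) s) has_real_derivative (avgz h r x s \<bullet> e) / r) (at 0)"
proof -
  obtain C where "\<And>x. \<bar>h x s\<bar> \<le> C"
    using tame_bound[OF h, of s] by (metis order_refl real_norm_def)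
  from gauss_shift_derivative[OF tame_slice[OF h] this r]
  show ?thesis
    unfolding avgz_inner[OF h] unfolding avg_def .
qed

text \<open>This is the fact that the Gaussian has mean zero, read off by differentiating the
  constant average of the function 1 under a shift.\<close>

lemma avgz_zero [simp]: "avgz h 0 x s = 0"
proof -
  have 1: "tame (\<lambda>(x::'a) s. 1::real)"
    by (rule tame_const_time[of _ 1]) auto
  have "avgz (\<lambda>_ _. 1) 1 (0::'a) 0 \<bullet> e = 0" for e :: 'a
    using DERIV_unique[OF avg_shift_derivative[OF 1, of 1 0 e 0], of 0] gauss.prob_space
    by (simp add: avg_def)
  then have "avgz (\<lambda>_ _. 1) 1 (0::'a) 0 = 0"
    by (metis inner_eq_zero_iff)
  then show ?thesis
    by (simp add: avgz_def)
qed

text \<open>Only derivatives along lines are recorded: they match the partial derivatives in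
  \<open>C21\<close>, and every differentiation below is in one real parameter.\<close>

definition has_gradient :: "('a::euclidean_space \<Rightarrow> real \<Rightarrow> real) \<Rightarrow> ('a \<Rightarrow> real \<Rightarrow> 'a) \<Rightarrow> bool" where
  "has_gradient h k \<longleftrightarrow> (\<forall>x s e. ((\<lambda>a. h (x + a *\<^sub>R e) s) has_real_derivative k x s \<bullet> e) (at 0))"

lemma has_gradientD:
  "has_gradient h k \<Longrightarrow> ((\<lambda>a. h (x + a *\<^sub>R e) s) has_real_derivative k (x + a *\<^sub>R e) s \<bullet> e) (at a)"
  unfolding has_gradient_def by (rule has_real_derivative_line) auto

lemma avg_gradient:
  assumes h: "tame h" and k: "tame k" and grad: "has_gradient h k"
  shows "((\<lambda>a. avg h r (x + a *\<^sub>R e) s) has_real_derivative avg (\<lambda>x s. k x s \<bullet> e) r x s) (at 0)"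
proof -
  note [measurable] = tame_measurable[OF tame_inner[OF k]]
  obtain C where C: "\<And>x. norm (k x s \<bullet> e) \<le> C"
    using tame_bound[OF tame_inner[OF k], of s] by (metis order_refl)
  have "((\<lambda>a. \<integral>z. h (x + r *\<^sub>R z + a *\<^sub>R e) s \<partial>gauss) has_real_derivative
      (\<integral>z. k (x + r *\<^sub>R z + 0 *\<^sub>R e) s \<bullet> e \<partial>gauss)) (at 0)"
  proof (rule has_real_derivative_integral_dominated[where d = 1 and w = "\<lambda>_. C"])
    show "integrable gauss (\<lambda>z. h (x + r *\<^sub>R z + a *\<^sub>R e) s)" for a
      using avg_integrable[OF h, of "x + a *\<^sub>R e" r s] by (simp add: algebra_simps)
    show "((\<lambda>a. h (x + r *\<^sub>R z + a *\<^sub>R e) s) has_real_derivative k (x + r *\<^sub>R z + a *\<^sub>R e) s \<bullet> e) (at a)" for a z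
      by (rule has_gradientD[OF grad])
  qed (use C in auto)
  then show ?thesis
    by (simp add: avg_def algebra_simps)
qed

text \<open>The derivative falls on \<open>h\<close>, so no factor 1/r appears and r = 0 is
  included. For r > 0 the sum equals r times the Laplacian of the average (apply
  \<open>avg_shift_derivative\<close> to the components of \<open>k\<close>): the heat equation in
  the variable r^2/2.\<close>

lemma avg_radial_derivative:
  fixes h :: "'a::euclidean_space \<Rightarrow> real \<Rightarrow> real"
  assumes h: "tame h" and k: "tame k" and grad: "has_gradient h k"
  shows "((\<lambda>r. avg h r x s) has_real_derivative (\<Sum>b\<in>Basis. avgz (\<lambda>x s. k x s \<bullet> b) r x s \<bullet> b)) (at r)"
proof -
  note [measurable] = tame_measurable[OF k]
  obtain C where C: "\<And>x. norm (k x s) \<le> C"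
    using tame_bound[OF k, of s] by (metis order_refl)
  have "((\<lambda>r. \<integral>z. h (x + r *\<^sub>R z) s \<partial>gauss) has_real_derivative
      (\<integral>z. k (x + r *\<^sub>R z) s \<bullet> z \<partial>gauss)) (at r)"
  proof (rule has_real_derivative_integral_dominated[where d = 1 and w = "\<lambda>z. C * norm z"])
    show "integrable gauss (\<lambda>z. h (x + a *\<^sub>R z) s)" for a
      by (rule avg_integrable[OF h])
    show "((\<lambda>a. h (x + a *\<^sub>R z) s) has_real_derivative k (x + a *\<^sub>R z) s \<bullet> z) (at a)" for a z
      by (rule has_gradientD[OF grad])
    show "\<bar>k (x + a *\<^sub>R z) s \<bullet> z\<bar> \<le> C * norm z" for a z
      by (rule order_trans[OF Cauchy_Schwarz_ineq2]) (auto intro!: mult_right_mono C)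
    show "integrable gauss (\<lambda>z::'a. C * norm z)"
      by (intro integrable_mult_right integrable_gauss_norm)
  qed auto
  moreover have "(\<integral>z. k (x + r *\<^sub>R z) s \<bullet> z \<partial>gauss) = (\<Sum>b\<in>Basis. avgz (\<lambda>x s. k x s \<bullet> b) r x s \<bullet> b)"
  proof -
    have "integrable gauss (\<lambda>z. (k (x + r *\<^sub>R z) s \<bullet> b) * (z \<bullet> b))" for b
      using integrable_inner_left[OF avgz_integrable[OF tame_inner[OF k, of b], of x r s], of b] by simp
    moreover have "(\<lambda>z. k (x + r *\<^sub>R z) s \<bullet> z) = (\<lambda>z. \<Sum>b\<in>Basis. (k (x + r *\<^sub>R z) s \<bullet> b) * (z \<bullet> b))"
      by (rule ext, rule euclidean_inner)
    ultimately show ?thesis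
      unfolding avgz_inner[OF tame_inner[OF k]] by (simp only: Bochner_Integration.integral_sum)
  qed
  ultimately show ?thesis
    by (simp add: avg_def)
qed

section \<open>Continuity and derivatives of the Duhamel integral\<close>

lemma duhamel_continuous:
  assumes h: "tame h"
  shows "continuous_on UNIV (\<lambda>(x, t). duhamel h x t)"
proof -
  have "continuous_on UNIV (\<lambda>p. integral (cbox 0 1) (\<lambda>\<rho>. \<rho> * avg h (sqrt (2 * snd p) * \<rho>) (fst p) (snd p * (1 - \<rho>\<^sup>2))))"
    by (rule integral_continuous_on_param)
      (auto simp: split_beta intro!: continuous_intros avg_continuous_on[OF h])
  then show ?thesis
    unfolding duhamel_def split_beta by (auto intro!: continuous_intros)
qed

lemma duhamelz_continuous:
  assumes h: "tame h"
  shows "continuous_on UNIV (\<lambda>(x, t). duhamelz h x t)"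
proof -
  have "continuous_on UNIV (\<lambda>p. integral (cbox 0 1) (\<lambda>\<rho>. avgz h (sqrt (2 * snd p) * \<rho>) (fst p) (snd p * (1 - \<rho>\<^sup>2))))"
    by (rule integral_continuous_on_param)
      (auto simp: split_beta intro!: continuous_intros avgz_continuous_on[OF h])
  then show ?thesis
    unfolding duhamelz_def split_beta by (auto intro!: continuous_intros)
qed

lemma heat_time_le: "0 \<le> t \<Longrightarrow> t * (1 - \<rho>\<^sup>2) \<le> (t::real)"
  by (simp add: algebra_simps)

lemma duhamel_integrand_integrable:
  assumes h: "tame h"
  shows "(\<lambda>\<rho>. \<rho> * avg h (sqrt (2 * t) * \<rho>) x (t * (1 - \<rho>\<^sup>2))) integrable_on {0..1}"
  by (intro integrable_continuous_real continuous_intros avg_continuous_on[OF h])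

lemma duhamelz_integrand_integrable:
  assumes h: "tame h"
  shows "(\<lambda>\<rho>. avgz h (sqrt (2 * t) * \<rho>) x (t * (1 - \<rho>\<^sup>2))) integrable_on {0..1}"
  by (intro integrable_continuous_real continuous_intros avgz_continuous_on[OF h])

lemma duhamelz_bounded:
  fixes h :: "'a::euclidean_space \<Rightarrow> real \<Rightarrow> real"
  assumes h: "tame h" and T: "T \<ge> 0"
  shows "\<exists>C. \<forall>x. \<forall>t\<in>{0..T}. norm (duhamelz h x t) \<le> C"
proof -
  obtain C where C: "C \<ge> 0" "\<And>x s. s \<le> T \<Longrightarrow> norm (h x s) \<le> C"
    using tame_bound[OF h] by metis
  let ?K = "C * (\<integral>z. norm z \<partial>(gauss :: 'a measure))"
  have K: "?K \<ge> 0"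
    using C by simp
  have "norm (duhamelz h x t) \<le> sqrt (2 * T) * ?K" if t: "t \<in> {0..T}" for x t
  proof -
    have "norm (integral {0..1} (\<lambda>\<rho>. avgz h (sqrt (2 * t) * \<rho>) x (t * (1 - \<rho>\<^sup>2)))) \<le> ?K * (1 - 0)"
    proof (rule integral_bound)
      fix \<rho> :: real
      show "norm (avgz h (sqrt (2 * t) * \<rho>) x (t * (1 - \<rho>\<^sup>2))) \<le> ?K"
        using t heat_time_le[of t \<rho>] C by (intro avgz_bound[OF h]) auto
    qed (auto intro!: continuous_intros avgz_continuous_on[OF h])
    then have "sqrt (2 * t) * norm (integral {0..1} (\<lambda>\<rho>. avgz h (sqrt (2 * t) * \<rho>) x (t * (1 - \<rho>\<^sup>2)))) \<le> sqrt (2 * T) * ?K"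
      using t K by (intro mult_mono) auto
    then show ?thesis
      using t by (simp add: duhamelz_def)
  qed
  then show ?thesis
    by blast
qed

text \<open>The smoothing step: a continuous, locally in time bounded source already yields a
  spatial gradient, because the derivative is carried by the kernel.\<close>

lemma duhamel_derivative:
  assumes h: "tame h" and t: "t \<ge> 0"
  shows "((\<lambda>a. duhamel h (x + a *\<^sub>R e) t) has_real_derivative duhamelz h x t \<bullet> e) (at 0)"
proof (cases "t = 0")
  case True
  then show ?thesis
    by (simp add: duhamel_def duhamelz_def)
next
  case False
  with t have t: "t > 0"
    by simp
  let ?R = "sqrt (2 * t)"
  have "((\<lambda>a. integral (cbox 0 1) (\<lambda>\<rho>. \<rho> * avg h (?R * \<rho>) (x + a *\<^sub>R e) (t * (1 - \<rho>\<^sup>2)))) has_real_derivative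
      integral (cbox 0 1) (\<lambda>\<rho>. avgz h (?R * \<rho>) (x + 0 *\<^sub>R e) (t * (1 - \<rho>\<^sup>2)) \<bullet> e / ?R)) (at 0 within UNIV)"
  proof (rule leibniz_rule_field_derivative)
    fix a \<rho> :: real
    assume \<rho>: "\<rho> \<in> cbox 0 1"
    show "((\<lambda>a. \<rho> * avg h (?R * \<rho>) (x + a *\<^sub>R e) (t * (1 - \<rho>\<^sup>2))) has_real_derivative
        avgz h (?R * \<rho>) (x + a *\<^sub>R e) (t * (1 - \<rho>\<^sup>2)) \<bullet> e / ?R) (at a within UNIV)"
    \<comment> \<open>For positive \<open>\<rho>\<close> the factor 1/\<open>\<rho>\<close> of the
      kernel derivative cancels the weight; at 0 the weight and \<open>avgz h 0\<close> both
      vanish.\<close>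
    proof (cases "\<rho> = 0")
      case False
      with \<rho> have "\<rho> > 0"
        by auto
      with t have "?R * \<rho> > 0"
        by simp
      from has_real_derivative_line[OF avg_shift_derivative[OF h this], of x _ _ a]
      show ?thesis
        using \<open>\<rho> > 0\<close> t by (auto intro!: derivative_eq_intros)
    qed simp
  qed (use t in \<open>auto simp: split_beta intro!: integrable_continuous_real continuous_intros
      avg_continuous_on[OF h] avgz_continuous_on[OF h]\<close>)
  then have "((\<lambda>a. duhamel h (x + a *\<^sub>R e) t) has_real_derivative
      2 * t * integral {0..1} (\<lambda>\<rho>. avgz h (?R * \<rho>) x (t * (1 - \<rho>\<^sup>2)) \<bullet> e / ?R)) (at 0)"
    unfolding duhamel_def by (auto intro!: derivative_eq_intros)
  also have "integral {0..1} (\<lambda>\<rho>. avgz h (?R * \<rho>) x (t * (1 - \<rho>\<^sup>2)) \<bullet> e / ?R) =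
      (integral {0..1} (\<lambda>\<rho>. avgz h (?R * \<rho>) x (t * (1 - \<rho>\<^sup>2))) \<bullet> e) / ?R"
    using integral_linear[OF duhamelz_integrand_integrable[OF h, of t x] bounded_linear_inner_left[of e]]
    by (simp add: o_def)
  also have "2 * t * \<dots> = duhamelz h x t \<bullet> e"
    using t by (simp add: duhamelz_def field_simps)
  finally show ?thesis .
qed

text \<open>The same directional derivative is computed twice, with the derivative on the kernel and
  on the source. The second form is again a Duhamel integral, so \<open>duhamel_derivative\<close>
  can be applied once more to obtain second derivatives.\<close>

lemma duhamelz_inner_eq:
  assumes h: "tame h" and k: "tame k" and grad: "has_gradient h k" and t: "t \<ge> 0"
  shows "duhamelz h x t \<bullet> e = duhamel (\<lambda>x s. k x s \<bullet> e) x t"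
proof -
  note ke = tame_inner[OF k, of e]
  let ?R = "sqrt (2 * t)"
  have "((\<lambda>a. integral (cbox 0 1) (\<lambda>\<rho>. \<rho> * avg h (?R * \<rho>) (x + a *\<^sub>R e) (t * (1 - \<rho>\<^sup>2)))) has_real_derivative
      integral (cbox 0 1) (\<lambda>\<rho>. \<rho> * avg (\<lambda>x s. k x s \<bullet> e) (?R * \<rho>) (x + 0 *\<^sub>R e) (t * (1 - \<rho>\<^sup>2)))) (at 0 within UNIV)"
  proof (rule leibniz_rule_field_derivative)
    fix a \<rho> :: real
    show "((\<lambda>a. \<rho> * avg h (?R * \<rho>) (x + a *\<^sub>R e) (t * (1 - \<rho>\<^sup>2))) has_real_derivative
        \<rho> * avg (\<lambda>x s. k x s \<bullet> e) (?R * \<rho>) (x + a *\<^sub>R e) (t * (1 - \<rho>\<^sup>2))) (at a within UNIV)"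
      by (rule DERIV_cmult, rule has_real_derivative_line[where F = "\<lambda>y. avg h (?R * \<rho>) y (t * (1 - \<rho>\<^sup>2))"
            and G = "\<lambda>y. avg (\<lambda>x s. k x s \<bullet> e) (?R * \<rho>) y (t * (1 - \<rho>\<^sup>2))"], rule avg_gradient[OF h k grad])
  qed (auto simp: split_beta intro!: integrable_continuous_real continuous_intros avg_continuous_on[OF h] avg_continuous_on[OF ke])
  then have "((\<lambda>a. duhamel h (x + a *\<^sub>R e) t) has_real_derivative duhamel (\<lambda>x s. k x s \<bullet> e) x t) (at 0)"
    unfolding duhamel_def by (auto intro!: derivative_eq_intros)
  with duhamel_derivative[OF h t] show ?thesis
    by (rule DERIV_unique)
qed

text \<open>The inhomogeneous heat equation: by \<open>duhamelz_inner_eq\<close> and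
  \<open>duhamel_derivative\<close> the sum is the Laplacian of \<open>duhamel h\<close>.
  \<open>parabolic_leibniz\<close> supplies it with no time derivative of \<open>h\<close>.\<close>

lemma duhamel_time_derivative:
  fixes h :: "'a::euclidean_space \<Rightarrow> real \<Rightarrow> real"
  assumes h: "tame h" and k: "tame k" and grad: "has_gradient h k" and t: "t > 0"
  shows "((\<lambda>t. duhamel h x t) has_real_derivative
    h x t + (\<Sum>b\<in>Basis. duhamelz (\<lambda>x s. k x s \<bullet> b) x t \<bullet> b)) (at t)"
proof -
  define \<Phi> where "\<Phi> r s = (\<Sum>b\<in>Basis. avgz (\<lambda>x s. k x s \<bullet> b) r x s \<bullet> b)" for r s
  let ?R = "sqrt (2 * t)"
  have "((\<lambda>t. duhamel h x t) has_real_derivative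
      avg h 0 x t + ?R * integral {0..1} (\<lambda>\<rho>. \<Phi> (?R * \<rho>) (t * (1 - \<rho>\<^sup>2)))) (at t)"
    unfolding duhamel_def
  proof (rule parabolic_leibniz[OF _ _ _ t])
    show "continuous_on UNIV (\<lambda>(r, s). avg h r x s)"
      unfolding split_beta by (intro avg_continuous_on[OF h] continuous_intros)
    show "continuous_on UNIV (\<lambda>(r, s). \<Phi> r s)"
      unfolding split_beta \<Phi>_def by (intro continuous_intros avgz_continuous_on[OF tame_inner[OF k]])
    show "((\<lambda>r. avg h r x s) has_real_derivative \<Phi> r s) (at r)" for r s
      unfolding \<Phi>_def by (rule avg_radial_derivative[OF h k grad])
  qed
  moreover have "integral {0..1} (\<lambda>\<rho>. \<Phi> (?R * \<rho>) (t * (1 - \<rho>\<^sup>2))) =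
      (\<Sum>b\<in>Basis. integral {0..1} (\<lambda>\<rho>. avgz (\<lambda>x s. k x s \<bullet> b) (?R * \<rho>) x (t * (1 - \<rho>\<^sup>2))) \<bullet> b)"
  proof -
    have "integral {0..1} (\<lambda>\<rho>. avgz (\<lambda>x s. k x s \<bullet> b) (?R * \<rho>) x (t * (1 - \<rho>\<^sup>2)) \<bullet> b) =
        integral {0..1} (\<lambda>\<rho>. avgz (\<lambda>x s. k x s \<bullet> b) (?R * \<rho>) x (t * (1 - \<rho>\<^sup>2))) \<bullet> b" for b
      using integral_linear[OF duhamelz_integrand_integrable[OF tame_inner[OF k, of b], of t x] bounded_linear_inner_left[of b]]
      by (simp add: o_def)
    moreover have "(\<lambda>\<rho>. avgz (\<lambda>x s. k x s \<bullet> b) (?R * \<rho>) x (t * (1 - \<rho>\<^sup>2)) \<bullet> b) integrable_on {0..1}" for b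
      by (intro integrable_continuous_real continuous_intros avgz_continuous_on[OF tame_inner[OF k]])
    ultimately show ?thesis
      unfolding \<Phi>_def by (simp add: integral_sum)
  qed
  ultimately show ?thesis
    by (simp add: duhamelz_def sum_distrib_left)
qed

section \<open>Solutions for Lipschitz nonlinearities\<close>

lemma avg_diff:
  assumes "tame h1" "tame h2"
  shows "avg (\<lambda>x s. h1 x s - h2 x s) r x s = avg h1 r x s - avg h2 r x s"
  unfolding avg_def by (intro Bochner_Integration.integral_diff avg_integrable assms)

lemma duhamel_diff:
  assumes "tame h1" "tame h2"
  shows "duhamel (\<lambda>x s. h1 x s - h2 x s) x t = duhamel h1 x t - duhamel h2 x t"
proof -
  have "\<rho> * avg (\<lambda>x s. h1 x s - h2 x s) r x s = \<rho> * avg h1 r x s - \<rho> * avg h2 r x s" for \<rho> r s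
    by (simp add: avg_diff[OF assms] right_diff_distrib)
  then show ?thesis
    unfolding duhamel_def
    by (simp only: Henstock_Kurzweil_Integration.integral_diff[OF
          duhamel_integrand_integrable[OF assms(1)] duhamel_integrand_integrable[OF assms(2)]])
      (rule right_diff_distrib)
qed

text \<open>The gain of 1/\<open>lam\<close> comes from integrating exp(\<open>lam\<close> s) in
  time; after \<open>s = t * (1 - \<rho>\<^sup>2)\<close> the majorant is an exact derivative in
  \<open>\<rho>\<close>. It makes the fixed point map a contraction on all times at once.\<close>

lemma duhamel_exp_bound:
  assumes h: "tame h" and lam: "lam > 0" and A: "A \<ge> 0" and t: "t \<ge> 0"
    and bound: "\<And>x s. \<bar>h x s\<bar> \<le> A * exp (lam * max s 0)"
  shows "\<bar>duhamel h x t\<bar> \<le> A / lam * exp (lam * t)"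
proof -
  let ?E = "\<lambda>\<rho>. 2 * t * (\<rho> * (A * exp (lam * (t * (1 - \<rho>\<^sup>2)))))"
  have E: "(?E has_integral (- A / lam * exp (lam * (t * (1 - 1\<^sup>2)))) - (- A / lam * exp (lam * (t * (1 - 0\<^sup>2))))) {0..1}"
  proof (rule fundamental_theorem_of_calculus)
    fix \<rho> :: real
    have "((\<lambda>\<rho>. - A / lam * exp (lam * (t * (1 - \<rho>\<^sup>2)))) has_real_derivative ?E \<rho>) (at \<rho>)"
      using lam by (auto intro!: derivative_eq_intros)
    then show "((\<lambda>\<rho>. - A / lam * exp (lam * (t * (1 - \<rho>\<^sup>2)))) has_vector_derivative ?E \<rho>) (at \<rho> within {0..1})"
      unfolding has_real_derivative_iff_has_vector_derivative by (rule has_vector_derivative_at_within)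
  qed simp
  have eq: "duhamel h x t = integral {0..1} (\<lambda>\<rho>. 2 * t * (\<rho> * avg h (sqrt (2 * t) * \<rho>) x (t * (1 - \<rho>\<^sup>2))))"
    by (simp add: duhamel_def)
  have "norm (duhamel h x t) \<le> integral {0..1} ?E"
    unfolding eq
  proof (rule integral_norm_bound_integral)
    show "(\<lambda>\<rho>. 2 * t * (\<rho> * avg h (sqrt (2 * t) * \<rho>) x (t * (1 - \<rho>\<^sup>2)))) integrable_on {0..1}"
      by (intro integrable_continuous_real continuous_intros avg_continuous_on[OF h])
    show "?E integrable_on {0..1}"
      using E by (rule has_integral_integrable)
    fix \<rho> :: real
    assume \<rho>: "\<rho> \<in> {0..1}"
    then have "\<rho>\<^sup>2 \<le> 1"
      by (simp add: power_le_one)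
    then have "t * (1 - \<rho>\<^sup>2) \<ge> 0"
      using t by simp
    then have eq: "max (t * (1 - \<rho>\<^sup>2)) 0 = t * (1 - \<rho>\<^sup>2)"
      by (rule max_absorb1)
    have "\<bar>avg h (sqrt (2 * t) * \<rho>) x (t * (1 - \<rho>\<^sup>2))\<bar> \<le> A * exp (lam * (t * (1 - \<rho>\<^sup>2)))"
      by (rule avg_bound[OF h]) (rule bound[of _ "t * (1 - \<rho>\<^sup>2)", unfolded eq])
    then have "\<rho> * \<bar>avg h (sqrt (2 * t) * \<rho>) x (t * (1 - \<rho>\<^sup>2))\<bar> \<le> \<rho> * (A * exp (lam * (t * (1 - \<rho>\<^sup>2))))"
      using \<rho> by (intro mult_left_mono) auto
    then show "norm (2 * t * (\<rho> * avg h (sqrt (2 * t) * \<rho>) x (t * (1 - \<rho>\<^sup>2)))) \<le> ?E \<rho>"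
      using \<rho> t by (simp add: abs_mult mult_left_mono)
  qed
  also have "\<dots> = A / lam * exp (lam * t) - A / lam"
    using integral_unique[OF E] by simp
  also have "\<dots> \<le> A / lam * exp (lam * t)"
    using A lam by simp
  finally show ?thesis
    by simp
qed

lemma mild_solution_exists:
  fixes g :: "real \<Rightarrow> real" and u0 :: "'a::euclidean_space \<Rightarrow> real"
  assumes g0: "g 0 = 0" and lip: "\<And>y z. \<bar>g y - g z\<bar> \<le> L * \<bar>y - z\<bar>"
    and u0: "continuous_on UNIV u0" and u0_bound: "\<And>x. \<bar>u0 x\<bar> \<le> C0"
  obtains w where "tame w"
    "\<And>x t. w x t = avg (\<lambda>x _. u0 x) (sqrt (2 * max t 0)) x 0 + duhamel (\<lambda>x s. g (w x s)) x (max t 0)"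
proof -
  \<comment> \<open>Then L/\<open>lam\<close> <= 1/2, the contraction constant, and
    \<open>lam\<close> is positive even if L = 0.\<close>
  define lam where "lam = 2 * L + 1"
  have L: "L \<ge> 0"
    using lip[of 1 0] by (metis abs_ge_zero abs_one diff_zero mult.right_neutral order_trans)
  then have lam: "lam > 0" "L / lam \<le> 1 / 2"
    by (auto simp: lam_def field_simps)
  have g: "continuous_on UNIV g"
  proof (rule continuous_onI)
    fix x e :: real
    assume "e > 0"
    show "\<exists>d>0. \<forall>x'\<in>UNIV. dist x' x < d \<longrightarrow> dist (g x') (g x) \<le> e"
    proof (intro exI[of _ "e / (L + 1)"] conjI ballI impI)
      fix x'
      assume "dist x' x < e / (L + 1)"
      then have "(L + 1) * \<bar>x' - x\<bar> \<le> e"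
        using L by (simp add: dist_real_def pos_less_divide_eq mult.commute)
      moreover have "L * \<bar>x' - x\<bar> \<le> (L + 1) * \<bar>x' - x\<bar>"
        by (simp add: mult_right_mono)
      ultimately show "dist (g x') (g x) \<le> e"
        using lip[of x' x] by (simp add: dist_real_def)
    qed (use \<open>e > 0\<close> L in auto)
  qed
  have tame_u0: "tame (\<lambda>x (_::real). u0 x)"
    using u0 u0_bound by (intro tame_const_time) auto
  \<comment> \<open>The unknown \<open>b\<close> is the solution weighted by exp(-\<open>lam\<close>
    t), sought in the complete space of bounded continuous functions on space-time; \<open>W\<close>
    removes the weight and \<open>P\<close> restores it.\<close>
  define W where "W b x s = exp (lam * max s 0) * apply_bcontfun b (x, s)" for b :: "('a \<times> real) \<Rightarrow>\<^sub>C real" and x s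
  define P where "P b = (\<lambda>(x, t). exp (- lam * max t 0) *
    (avg (\<lambda>x _. u0 x) (sqrt (2 * max t 0)) x 0 + duhamel (\<lambda>x s. g (W b x s)) x (max t 0)))" for b
  have tame_W: "tame (W b)" for b
    unfolding tame_def
  proof (intro conjI allI)
    fix T
    show "continuous_on UNIV (\<lambda>(x, s). W b x s)"
      unfolding W_def split_beta by (auto intro!: continuous_intros)
    have "\<forall>x. \<forall>s\<le>T. norm (W b x s) \<le> exp (lam * max T 0) * norm b"
      unfolding W_def norm_mult using lam norm_bounded[of b] by (auto intro!: mult_mono)
    then show "\<exists>C. \<forall>x. \<forall>s\<le>T. norm (W b x s) \<le> C"
      by blast
  qed
  have W_diff: "\<bar>g (W b x s) - g (W c x s)\<bar> \<le> (L * dist b c) * exp (lam * max s 0)" for b c x s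
  proof -
    have "\<bar>g (W b x s) - g (W c x s)\<bar> \<le> L * (exp (lam * max s 0) * dist (apply_bcontfun b (x, s)) (apply_bcontfun c (x, s)))"
      using lip[of "W b x s" "W c x s"] by (simp add: W_def dist_real_def abs_mult flip: right_diff_distrib)
    also have "\<dots> \<le> L * (exp (lam * max s 0) * dist b c)"
      using L by (intro mult_left_mono dist_bounded) auto
    finally show ?thesis
      by (simp add: mult_ac)
  qed
  have tame_gW: "tame (\<lambda>x s. g (W b x s))" for b
    by (rule tame_compose[OF tame_W g])
  have P_diff: "\<bar>P b p - P c p\<bar> \<le> 1 / 2 * dist b c" for b c p
  proof (cases p)
    case (Pair x t)
    let ?t = "max t 0"
    have "\<bar>duhamel (\<lambda>x s. g (W b x s) - g (W c x s)) x ?t\<bar> \<le> (L * dist b c) / lam * exp (lam * ?t)"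
      by (rule duhamel_exp_bound[OF _ lam(1) _ _ W_diff])
        (use L tame_add[OF tame_gW[of b] tame_compose[OF tame_gW[of c] continuous_on_minus[OF continuous_on_id]]] in auto)
    then have "exp (- lam * ?t) * \<bar>duhamel (\<lambda>x s. g (W b x s) - g (W c x s)) x ?t\<bar> \<le>
        exp (- lam * ?t) * ((L * dist b c) / lam * exp (lam * ?t))"
      by (intro mult_left_mono) auto
    also have "\<dots> = L / lam * dist b c"
      by (simp add: exp_minus field_simps)
    also have "\<dots> \<le> 1 / 2 * dist b c"
      using lam by (intro mult_right_mono) auto
    finally show ?thesis
      unfolding Pair P_def by (simp add: duhamel_diff[OF tame_gW tame_gW] abs_mult flip: right_diff_distrib)
  qed
  have P_cont: "P b \<in> bcontfun" for b
  proof (rule bcontfun_normI)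
    have "continuous_on UNIV (\<lambda>(x, t). duhamel (\<lambda>x s. g (W b x s)) x (max t 0))"
      unfolding split_beta
      by (intro continuous_on_curried[OF duhamel_continuous[OF tame_gW]] continuous_intros)
    then show "continuous_on UNIV (P b)"
      unfolding P_def split_beta by (intro continuous_intros avg_continuous_on[OF tame_u0])
    show "norm (P b p) \<le> C0 + 1 / 2 * dist b 0" for p
    proof (cases p)
      case (Pair x t)
      let ?t = "max t 0"
      have "duhamel (\<lambda>_ _. 0) x ?t = 0"
        by (simp add: duhamel_def avg_def)
      then have "P 0 p = exp (- lam * ?t) * avg (\<lambda>x _. u0 x) (sqrt (2 * ?t)) x 0"
        by (simp add: Pair P_def W_def g0)
      also have "\<bar>\<dots>\<bar> \<le> 1 * C0"
        unfolding abs_mult using lam(1) u0_bound by (intro mult_mono avg_bound[OF tame_u0]) auto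
      finally show ?thesis
        using P_diff[of b p 0] unfolding real_norm_def by arith
    qed
  qed
  have "\<exists>!b. Bcontfun (P b) = b"
  proof (rule banach_fix_type)
    show "\<forall>b c. dist (Bcontfun (P b)) (Bcontfun (P c)) \<le> 1 / 2 * dist b c"
    proof (intro allI dist_bound)
      fix b c p
      show "dist (apply_bcontfun (Bcontfun (P b)) p) (apply_bcontfun (Bcontfun (P c)) p) \<le> 1 / 2 * dist b c"
        using P_diff[of b p c] by (simp add: Bcontfun_inverse[OF P_cont] dist_real_def)
    qed
  qed auto
  then obtain b where "Bcontfun (P b) = b"
    by blast
  then have "apply_bcontfun b = P b"
    using Bcontfun_inverse[OF P_cont[of b]] by simp
  then have "W b x t = avg (\<lambda>x _. u0 x) (sqrt (2 * max t 0)) x 0 + duhamel (\<lambda>x s. g (W b x s)) x (max t 0)" for x t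
    unfolding W_def[of b x t] by (simp add: P_def exp_minus)
  with tame_W show ?thesis
    by (rule that)
qed

lemma sum_Basis_axis: "sum f (Basis :: (real ^ 'n::finite) set) = (\<Sum>i\<in>UNIV. f (axis i 1))"
proof -
  have "(Basis :: (real ^ 'n) set) = range (\<lambda>i. axis i 1)"
    by (auto simp: Basis_vec_def)
  moreover have "inj (\<lambda>i::'n. axis i (1::real))"
    by (auto simp: inj_on_def axis_eq_axis)
  ultimately show ?thesis
    using sum.reindex[of "\<lambda>i. axis i 1" UNIV f] by (simp add: o_def)
qed

text \<open>Bootstrap in two rounds. A continuous source gives \<open>w\<close> the gradient
  \<open>kw\<close>; then g(w) has the gradient g'(w) \<open>kw\<close>, and its Duhamel integral
  has second derivatives and a time derivative. Only g', never g'', is used.\<close>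

lemma semilinear_heat_solution:
  fixes g g' :: "real \<Rightarrow> real" and u0 :: "real ^ 'n::finite \<Rightarrow> real" and k0 :: "real ^ 'n \<Rightarrow> real ^ 'n"
  assumes g0: "g 0 = 0" and g: "\<And>y. (g has_real_derivative g' y) (at y)"
    and g'_cont: "continuous_on UNIV g'" and g'_bound: "\<And>y. \<bar>g' y\<bar> \<le> L"
    and u0_cont: "continuous_on UNIV u0" and u0_bound: "\<And>x. \<bar>u0 x\<bar> \<le> C0"
    and k0_cont: "continuous_on UNIV k0" and k0_bound: "\<And>x. norm (k0 x) \<le> C1"
    and k0: "\<And>x e. ((\<lambda>a. u0 (x + a *\<^sub>R e)) has_real_derivative k0 x \<bullet> e) (at 0)"
  obtains w where "tame w" "C21 w" "\<And>x. w x 0 = u0 x"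
    "\<And>x t. t > 0 \<Longrightarrow> deriv (\<lambda>s. w x s) t = laplacian (\<lambda>y. w y t) x + g (w x t)"
proof -
  have lip: "\<bar>g y - g z\<bar> \<le> L * \<bar>y - z\<bar>" for y z
    using field_differentiable_bound[of UNIV g g' L y z] g g'_bound by auto
  obtain w where w: "tame w" and w_eq:
    "\<And>x t. w x t = avg (\<lambda>x _. u0 x) (sqrt (2 * max t 0)) x 0 + duhamel (\<lambda>x s. g (w x s)) x (max t 0)"
    using mild_solution_exists[of g L u0 C0] g0 lip u0_cont u0_bound by metis
  define h where "h x s = g (w x s)" for x s
  have g_cont: "continuous_on UNIV g"
    by (intro continuous_at_imp_continuous_on ballI DERIV_isCont[OF g])
  have h: "tame h"
    unfolding h_def by (rule tame_compose[OF w g_cont])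
  have tu0: "tame (\<lambda>x (_::real). u0 x)"
    using u0_cont u0_bound by (intro tame_const_time) auto
  have tk0: "tame (\<lambda>x (_::real). k0 x)"
    using k0_cont k0_bound by (intro tame_const_time) auto
  have gk0: "has_gradient (\<lambda>x _. u0 x) (\<lambda>x _. k0 x)"
    using k0 by (simp add: has_gradient_def)
  note tk0e = tame_inner[OF tk0]
  define K where "K x t = (\<integral>z. k0 (x + sqrt (2 * t) *\<^sub>R z) \<partial>gauss)" for x t
  have [measurable]: "k0 \<in> borel_measurable borel"
    using k0_cont by (rule borel_measurable_continuous_onI)
  have k0_int: "integrable gauss (\<lambda>z. k0 (x + r *\<^sub>R z))" for x r
    using k0_bound by (intro gauss.integrable_const_bound[of _ C1]) auto
  have K_inner: "K x t \<bullet> e = avg (\<lambda>x s. k0 x \<bullet> e) (sqrt (2 * t)) x 0" for x t e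
    unfolding K_def avg_def by (rule integral_inner_left[symmetric]) (rule k0_int)
  have K_cont: "continuous_on UNIV (\<lambda>(x, t). K x t)"
    unfolding continuous_on_eq_continuous_at[OF open_UNIV] K_def split_beta
  proof (intro ballI isCont_integral_dominated[where U = UNIV and w = "\<lambda>_. C1"])
    show "isCont (\<lambda>p. k0 (fst p + sqrt (2 * snd p) *\<^sub>R z)) p" for p z
      by (rule continuous_on_interior[of UNIV])
        (auto intro!: continuous_on_compose2[OF k0_cont] continuous_intros)
  qed (use k0_bound in auto)
  have K_bound: "norm (K x t) \<le> C1" for x t
  proof -
    have "norm (K x t) \<le> (\<integral>z. norm (k0 (x + sqrt (2 * t) *\<^sub>R z)) \<partial>gauss)"
      unfolding K_def by (rule integral_norm_bound)
    also have "\<dots> \<le> (\<integral>z. C1 \<partial>(gauss :: (real ^ 'n) measure))"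
      by (intro integral_mono integrable_norm k0_int k0_bound) auto
    finally show ?thesis
      by simp
  qed
  \<comment> \<open>In the heat flow part the derivative is put on \<open>u0\<close>, not on the
    kernel. This avoids a singularity like 1/sqrt(t) and keeps \<open>kw\<close> continuous and
    bounded at t = 0, as tameness requires.\<close>
  define kw where "kw x t = K x (max t 0) + duhamelz h x (max t 0)" for x t
  have kw: "tame kw"
    unfolding kw_def using K_bound
    by (intro tame_add tame_clamp K_cont duhamelz_continuous h duhamelz_bounded) auto
  have w_h: "w x t = avg (\<lambda>x _. u0 x) (sqrt (2 * max t 0)) x 0 + duhamel h x (max t 0)" for x t
    unfolding h_def by (rule w_eq)
  have grad_w: "has_gradient w kw"
    unfolding has_gradient_def w_h kw_def inner_add_left K_inner
    by (intro allI DERIV_add avg_gradient[OF tu0 tk0 gk0] duhamel_derivative[OF h]) auto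
  define kh where "kh x s = g' (w x s) *\<^sub>R kw x s" for x s
  have kh: "tame kh"
    unfolding kh_def by (rule tame_scaleR[OF tame_compose[OF w g'_cont] kw])
  have grad_h: "has_gradient h kh"
    unfolding has_gradient_def h_def kh_def
  proof (intro allI)
    fix x s e
    have "((\<lambda>a. w (x + a *\<^sub>R e) s) has_real_derivative kw x s \<bullet> e) (at 0)"
      using grad_w by (simp add: has_gradient_def)
    from DERIV_chain2[OF g this]
    show "((\<lambda>a. g (w (x + a *\<^sub>R e) s)) has_real_derivative (g' (w x s) *\<^sub>R kw x s) \<bullet> e) (at 0)"
      by simp
  qed
  note khe = tame_inner[OF kh]
  \<comment> \<open>\<open>H b e\<close> is the second derivative of \<open>w\<close> in directions
    b and e. The second derivative of the heat flow must fall on the kernel, whence the factor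
    1/sqrt(2t) and the restriction to t > 0.\<close>
  define H where "H b e x t = (avgz (\<lambda>x s. k0 x \<bullet> b) (sqrt (2 * t)) x 0 \<bullet> e) / sqrt (2 * t) +
    duhamelz (\<lambda>x s. kh x s \<bullet> b) x t \<bullet> e" for b e x t
  have second: "((\<lambda>a. kw (x + a *\<^sub>R e) t \<bullet> b) has_real_derivative H b e x t) (at 0)" if t: "t > 0" for x t b e
  proof -
    have "kw x t \<bullet> b = avg (\<lambda>x s. k0 x \<bullet> b) (sqrt (2 * t)) x 0 + duhamel (\<lambda>x s. kh x s \<bullet> b) x t" for x
      using t duhamelz_inner_eq[OF h kh grad_h, of t x b] by (simp add: kw_def inner_add_left K_inner)
    then show ?thesis
      unfolding H_def using t
      by (simp only:) (rule DERIV_add, rule avg_shift_derivative[OF tk0e], simp, rule duhamel_derivative[OF khe], simp)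
  qed
  have time: "((\<lambda>t. w x t) has_real_derivative (\<Sum>b\<in>Basis. H b b x t) + h x t) (at t)" if t: "t > 0" for x t
  proof -
    \<comment> \<open>The derivative 1/sqrt(2t) of the radius sqrt(2t) turns the radial derivative
      into the trace of the first summand of \<open>H\<close>.\<close>
    have "((\<lambda>t. avg (\<lambda>x _. u0 x) (sqrt (2 * t)) x 0) has_real_derivative
        (\<Sum>b\<in>Basis. avgz (\<lambda>x s. k0 x \<bullet> b) (sqrt (2 * t)) x 0 \<bullet> b) * (1 / sqrt (2 * t))) (at t)"
      using t by (intro DERIV_chain2[OF avg_radial_derivative[OF tu0 tk0 gk0]])
        (auto intro!: derivative_eq_intros simp: field_simps)
    from DERIV_add[OF this duhamel_time_derivative[OF h kh grad_h t, of x]]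
    have "((\<lambda>t. avg (\<lambda>x _. u0 x) (sqrt (2 * t)) x 0 + duhamel h x t) has_real_derivative
        (\<Sum>b\<in>Basis. H b b x t) + h x t) (at t)"
      by (simp add: H_def sum.distrib sum_divide_distrib add_ac)
    then show ?thesis
      by (rule has_field_derivative_transform_within_open[where S = "{0<..}"]) (use t in \<open>auto simp: w_h\<close>)
  qed
  have H_cont: "continuous_on (UNIV \<times> {0<..}) (\<lambda>(x, t). H b e x t)" for b e
    unfolding H_def split_beta
    by (intro continuous_intros avgz_continuous_on[OF tk0e] continuous_on_curried[OF duhamelz_continuous[OF khe]]) auto
  have first: "((\<lambda>a. w (x + a *\<^sub>R axis i 1) t) has_real_derivative kw x t \<bullet> axis i 1) (at 0)" for x t i
    using grad_w by (simp add: has_gradient_def)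
  have pd1: "partial_deriv i (\<lambda>y. w y t) = (\<lambda>y. kw y t \<bullet> axis i 1)" for i t
    unfolding partial_deriv_def using first by (auto intro!: DERIV_imp_deriv)
  have pd2: "partial_deriv j (\<lambda>y. kw y t \<bullet> axis i 1) x = H (axis i 1) (axis j 1) x t" if "t > 0" for i j t x
    unfolding partial_deriv_def using second[OF that] by (auto intro!: DERIV_imp_deriv)
  have dt: "deriv (\<lambda>s. w x s) t = (\<Sum>b\<in>Basis. H b b x t) + h x t" if "t > 0" for x t
    using time[OF that] by (rule DERIV_imp_deriv)
  have "C21 w"
    unfolding C21_def pd1
  proof (intro conjI allI impI)
    show "continuous_on (UNIV \<times> {0<..}) (\<lambda>(x, t). w x t)"
      using tame_cont[OF w] continuous_on_subset by blast
    show "(\<lambda>s. w x s) field_differentiable at t" if "t > 0" for x t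
      using time[OF that] unfolding field_differentiable_def by blast
    have "continuous_on (UNIV \<times> {0<..}) (\<lambda>p. (\<Sum>b\<in>Basis. H b b (fst p) (snd p)) + h (fst p) (snd p))"
      using H_cont by (auto simp: split_beta intro!: continuous_intros tame_continuous_on[OF h])
    then show "continuous_on (UNIV \<times> {0<..}) (\<lambda>(x, t). deriv (\<lambda>s. w x s) t)"
      by (rule continuous_on_eq) (auto simp: dt)
    fix i j :: 'n
    show "partial_differentiable i (\<lambda>y. w y t) x" for x t
      unfolding partial_differentiable_def field_differentiable_def using first by blast
    show "continuous_on (UNIV \<times> {0<..}) (\<lambda>(x, t). kw x t \<bullet> axis i 1)"
      unfolding split_beta by (intro continuous_intros tame_continuous_on[OF kw])
    show "partial_differentiable j (\<lambda>y. kw y t \<bullet> axis i 1) x" if "t > 0" for x t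
      unfolding partial_differentiable_def field_differentiable_def using second[OF that] by blast
    show "continuous_on (UNIV \<times> {0<..}) (\<lambda>(x, t). partial_deriv j (\<lambda>y. kw y t \<bullet> axis i 1) x)"
      by (rule continuous_on_eq[OF H_cont[of "axis i 1" "axis j 1"]]) (auto simp: pd2)
  qed
  moreover have "w x 0 = u0 x" for x
    by (simp add: w_h duhamel_def)
  moreover have "deriv (\<lambda>s. w x s) t = laplacian (\<lambda>y. w y t) x + g (w x t)" if "t > 0" for x t
    using that by (simp add: dt laplacian_def pd1 pd2 sum_Basis_axis h_def)
  ultimately show ?thesis
    using that w by blast
qed

section \<open>Comparison and a radial barrier\<close>

lemma second_derivative_nonneg_at_min:
  fixes \<phi> :: "real \<Rightarrow> real"
  assumes d1: "\<And>a. (\<phi> has_real_derivative \<phi>' a) (at a)" and d2: "(\<phi>' has_real_derivative D) (at 0)"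
    and min: "\<And>a. \<phi> 0 \<le> \<phi> a"
  shows "D \<ge> 0"
proof (rule ccontr)
  assume "\<not> D \<ge> 0"
  then have "D < 0"
    by simp
  from DERIV_neg_dec_right[OF d2 this] obtain d where d: "d > 0" "\<And>h. h > 0 \<Longrightarrow> h < d \<Longrightarrow> \<phi>' h < \<phi>' 0"
    by auto
  have "\<phi>' 0 = 0"
    by (rule DERIV_local_min[OF d1, of 1]) (use min in auto)
  obtain \<xi> where "0 < \<xi>" "\<xi> < d / 2" "\<phi> (d / 2) - \<phi> 0 = (d / 2 - 0) * \<phi>' \<xi>"
    using MVT2[of 0 "d / 2" \<phi> \<phi>'] d d1 by auto
  moreover from this have "\<phi>' \<xi> < 0"
    using d(2)[of \<xi>] \<open>\<phi>' 0 = 0\<close> by simp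
  ultimately show False
    using min[of "d / 2"] d(1) mult_pos_neg[of d "\<phi>' \<xi>"] by simp
qed

text \<open>An exponential weight gives strictness and a quadratic penalty makes the minimum
  attained on the unbounded space. The differential inequality is asked only where \<open>z\<close>
  is negative, since the negative minimum is the only point at which it is evaluated.\<close>

lemma comparison_principle:
  fixes z :: "real ^ 'n::finite \<Rightarrow> real \<Rightarrow> real"
  assumes L: "L \<ge> 0"
    and cont: "continuous_on (UNIV \<times> {0..}) (\<lambda>(x, t). z x t)"
    and lower: "\<And>T. \<exists>C. \<forall>x. \<forall>t\<in>{0..T}. C \<le> z x t"
    and init: "\<And>x. z x 0 \<ge> 0"
    and first: "\<And>i x t. t > 0 \<Longrightarrow> ((\<lambda>a. z (x + a *\<^sub>R axis i 1) t) has_real_derivative zx i x t) (at 0)"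
    and second: "\<And>i x t. t > 0 \<Longrightarrow> ((\<lambda>a. zx i (x + a *\<^sub>R axis i 1) t) has_real_derivative zxx i x t) (at 0)"
    and time: "\<And>x t. t > 0 \<Longrightarrow> ((\<lambda>s. z x s) has_real_derivative zt x t) (at t)"
    and ineq: "\<And>x t. t > 0 \<Longrightarrow> z x t < 0 \<Longrightarrow> L * z x t \<le> zt x t - (\<Sum>i\<in>UNIV. zxx i x t)"
    and t0: "t0 \<ge> 0"
  shows "z x0 t0 \<ge> 0"
proof (rule ccontr)
  assume "\<not> z x0 t0 \<ge> 0"
  then have neg: "z x0 t0 < 0"
    by simp
  \<comment> \<open>The excess of 1 over L leaves the margin -exp(-\<open>?lam\<close> t1) z(x1,
    t1), which must beat the Laplacian of the penalty.\<close>
  let ?lam = "L + 1" and ?N = "real CARD('n)"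
  define \<eta> where "\<eta> = - (exp (- ?lam * t0) * z x0 t0)"
  have \<eta>: "\<eta> > 0"
    using neg by (simp add: \<eta>_def mult_pos_neg)
  \<comment> \<open>Small enough that both the penalty at \<open>x0\<close> and its Laplacian, 2 N
    \<open>\<epsilon>\<close>, stay below half of the depth \<open>\<eta>\<close>.\<close>
  define \<epsilon> where "\<epsilon> = \<eta> / (2 * ((norm x0)\<^sup>2 + 2 * ?N + 1))"
  have den: "(norm x0)\<^sup>2 + 2 * ?N + 1 > 0"
    by (simp add: add_nonneg_pos)
  have \<epsilon>: "\<epsilon> > 0"
    using \<eta> den by (simp add: \<epsilon>_def)
  have "\<epsilon> * ((norm x0)\<^sup>2 + 2 * ?N + 1) = \<eta> / 2"
    using den by (simp add: \<epsilon>_def field_simps)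
  then have sum: "\<epsilon> * (norm x0)\<^sup>2 + 2 * \<epsilon> * ?N + \<epsilon> = \<eta> / 2"
    by (simp add: algebra_simps)
  have "\<epsilon> * (norm x0)\<^sup>2 \<ge> 0" "2 * \<epsilon> * ?N \<ge> 0"
    using \<epsilon> by auto
  with sum \<epsilon> have \<epsilon>1: "\<epsilon> * (norm x0)\<^sup>2 < \<eta> / 2" and \<epsilon>2: "2 * \<epsilon> * ?N < \<eta> / 2"
    by linarith+
  define \<psi> where "\<psi> x t = exp (- ?lam * t) * z x t + \<epsilon> * (norm x)\<^sup>2" for x t
  have "\<psi> x0 t0 = - \<eta> + \<epsilon> * (norm x0)\<^sup>2"
    by (simp add: \<psi>_def \<eta>_def)
  with \<epsilon>1 have \<psi>0: "\<psi> x0 t0 < - \<eta> / 2"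
    by linarith
  obtain C where C: "\<And>x t. t \<in> {0..t0} \<Longrightarrow> C \<le> z x t"
    using lower[of t0] by blast
  \<comment> \<open>Outside this ball the penalty exceeds |C| and so makes \<open>\<psi>\<close>
    nonnegative; the minimum over the compact cylinder is thus one over the whole strip.\<close>
  define R where "R = \<bar>C\<bar> / \<epsilon> + 1 + norm x0"
  have R: "R \<ge> 1" "R \<ge> norm x0" "\<epsilon> * R \<ge> \<bar>C\<bar>"
    using \<epsilon> by (auto simp: R_def field_simps)
  have "\<exists>p\<in>cball 0 R \<times> {0..t0}. \<forall>q\<in>cball 0 R \<times> {0..t0}. (\<lambda>(x, t). \<psi> x t) p \<le> (\<lambda>(x, t). \<psi> x t) q"
  proof (rule continuous_attains_inf)
    show "compact (cball (0 :: real ^ 'n) R \<times> {0..t0})"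
      by (intro compact_Times) auto
    show "cball (0 :: real ^ 'n) R \<times> {0..t0} \<noteq> {}"
      using R t0 by auto
    have "continuous_on (cball 0 R \<times> {0..t0}) (\<lambda>(x, t). z x t)"
      by (rule continuous_on_subset[OF cont]) auto
    then show "continuous_on (cball 0 R \<times> {0..t0}) (\<lambda>(x, t). \<psi> x t)"
      unfolding \<psi>_def split_beta by (intro continuous_intros)
  qed
  then obtain x1 t1 where t1: "t1 \<in> {0..t0}" "norm x1 \<le> R"
    and min: "\<And>x t. norm x \<le> R \<Longrightarrow> t \<in> {0..t0} \<Longrightarrow> \<psi> x1 t1 \<le> \<psi> x t"
    by auto
  have \<psi>1: "\<psi> x1 t1 < - \<eta> / 2"
    using min[of x0 t0] R t0 \<psi>0 by simp
  have glob: "\<psi> x1 t1 \<le> \<psi> x t" if t: "t \<in> {0..t0}" for x t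
  proof (cases "norm x \<le> R")
    case False
    have "exp (- ?lam * t) * z x t \<ge> - \<bar>C\<bar>"
    proof -
      have "exp (- ?lam * t) * (- z x t) \<le> exp (- ?lam * t) * \<bar>C\<bar>"
        using C[OF t, of x] by (intro mult_left_mono) auto
      also have "\<dots> \<le> 1 * \<bar>C\<bar>"
        using L t by (intro mult_right_mono) (auto simp: mult_nonpos_nonneg)
      finally show ?thesis
        by simp
    qed
    moreover have "\<epsilon> * (norm x)\<^sup>2 \<ge> \<bar>C\<bar>"
    proof -
      have "R \<le> norm x * 1"
        using False by simp
      also have "\<dots> \<le> norm x * norm x"
        using R(1) False by (intro mult_left_mono) auto
      finally have "\<epsilon> * R \<le> \<epsilon> * (norm x)\<^sup>2"
        using \<epsilon> by (simp add: power2_eq_square)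
      with R(3) show ?thesis
        by simp
    qed
    ultimately have "\<psi> x t \<ge> 0"
      by (simp add: \<psi>_def)
    with \<psi>1 \<eta> show ?thesis
      by simp
  qed (use t min in auto)
  have t1_pos: "t1 > 0"
  proof (rule ccontr)
    assume "\<not> t1 > 0"
    with t1 have "\<psi> x1 t1 \<ge> 0"
      using init \<epsilon> by (simp add: \<psi>_def)
    with \<psi>1 \<eta> show False
      by simp
  qed
  let ?E = "exp (- ?lam * t1)"
  have Ez: "?E * z x1 t1 < - \<eta> / 2"
  proof -
    have "\<epsilon> * (norm x1)\<^sup>2 \<ge> 0"
      using \<epsilon> by simp
    with \<psi>1 show ?thesis
      unfolding \<psi>_def by linarith
  qed
  then have "?E * z x1 t1 < 0"
    using \<eta> by linarith
  then have z_neg: "z x1 t1 < 0"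
    by (simp add: mult_less_0_iff)
  \<comment> \<open>The minimum may sit at the final time \<open>t0\<close>, so only earlier times
    are compared and just the sign of the time derivative is obtained.\<close>
  have zt: "?E * zt x1 t1 \<le> ?E * (?lam * z x1 t1)"
  proof (rule ccontr)
    assume *: "\<not> ?thesis"
    have "((\<lambda>s. \<psi> x1 s) has_real_derivative ?E * zt x1 t1 - ?E * (?lam * z x1 t1)) (at t1)"
      unfolding \<psi>_def using time[OF t1_pos, of x1] by (auto intro!: derivative_eq_intros simp: algebra_simps)
    from DERIV_pos_inc_left[OF this] * obtain d where d: "d > 0" "\<And>h. h > 0 \<Longrightarrow> h < d \<Longrightarrow> \<psi> x1 (t1 - h) < \<psi> x1 t1"
      by auto
    define h where "h = min d t1 / 2"
    have "h > 0" "h < d" "t1 - h \<in> {0..t0}"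
      using d(1) t1_pos t1 by (auto simp: h_def min_def)
    with d(2)[of h] glob[of "t1 - h" x1] show False
      by simp
  qed
  have zxx: "?E * zxx i x1 t1 + 2 * \<epsilon> \<ge> 0" for i
  proof (rule second_derivative_nonneg_at_min)
    let ?e = "axis i 1 :: real ^ 'n"
    have sq: "(norm (x1 + a *\<^sub>R ?e))\<^sup>2 = (norm x1)\<^sup>2 + 2 * a * (x1 \<bullet> ?e) + a\<^sup>2" for a
      unfolding power2_norm_eq_inner
      by (simp add: inner_add_left inner_add_right inner_commute[of ?e x1] inner_axis_axis power2_eq_square algebra_simps)
    show "((\<lambda>a. \<psi> (x1 + a *\<^sub>R ?e) t1) has_real_derivative
        ?E * zx i (x1 + a *\<^sub>R ?e) t1 + \<epsilon> * (2 * (x1 \<bullet> ?e) + 2 * a)) (at a)" for a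
      unfolding \<psi>_def sq
      by (auto intro!: derivative_eq_intros has_real_derivative_line[of "\<lambda>y. z y t1"] first[OF t1_pos])
    show "((\<lambda>a. ?E * zx i (x1 + a *\<^sub>R ?e) t1 + \<epsilon> * (2 * (x1 \<bullet> ?e) + 2 * a)) has_real_derivative
        ?E * zxx i x1 t1 + 2 * \<epsilon>) (at 0)"
      using second[OF t1_pos, of i x1] by (auto intro!: derivative_eq_intros)
    show "\<psi> (x1 + 0 *\<^sub>R ?e) t1 \<le> \<psi> (x1 + a *\<^sub>R ?e) t1" for a
      using glob[OF t1(1)] by simp
  qed
  have "(\<Sum>i\<in>(UNIV :: 'n set). - (2 * \<epsilon>)) \<le> (\<Sum>i\<in>UNIV. ?E * zxx i x1 t1)"
  proof (rule sum_mono)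
    show "- (2 * \<epsilon>) \<le> ?E * zxx i x1 t1" for i
      using zxx[of i] by linarith
  qed
  then have "- (2 * \<epsilon> * ?N) \<le> ?E * (\<Sum>i\<in>UNIV. zxx i x1 t1)"
    unfolding sum_distrib_left[symmetric] by (simp add: mult_ac)
  moreover have "?E * (L * z x1 t1) \<le> ?E * (zt x1 t1 - (\<Sum>i\<in>UNIV. zxx i x1 t1))"
    by (intro mult_left_mono ineq t1_pos z_neg) auto
  ultimately have "?E * (L * z x1 t1) \<le> ?E * (?lam * z x1 t1) + 2 * \<epsilon> * ?N"
    using zt unfolding right_diff_distrib[of "exp _"] by linarith
  then have "- (?E * z x1 t1) \<le> 2 * \<epsilon> * ?N"
    by (simp add: algebra_simps)
  with Ez \<epsilon>2 show False
    by linarith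
qed

section \<open>The radial supersolution of the heat equation\<close>

text \<open>In the variables \<open>s = |x|\<^sup>2\<close> and \<open>\<tau> = 1 + t\<close>, the first term has the required decay, the second makes it a strict supersolution where
  \<open>s\<close> is large compared with \<open>\<tau>\<close>, and the multiple of the slowed-down heat kernel does so elsewhere;
  the last step needs \<open>m < N/2\<close>.\<close>

definition barrier :: "real \<Rightarrow> real \<Rightarrow> real \<Rightarrow> real \<Rightarrow> real \<Rightarrow> real" where
  "barrier m c K s \<tau> = (\<tau> + s) powr (-m) + c * \<tau> * (\<tau> + s) powr (-m-1) + K * \<tau> powr (-m) * exp (- s / (4 * \<tau>))"

definition barrier_s :: "real \<Rightarrow> real \<Rightarrow> real \<Rightarrow> real \<Rightarrow> real \<Rightarrow> real" where
  "barrier_s m c K s \<tau> = - m * (\<tau> + s) powr (-m-1) - c * \<tau> * (m + 1) * (\<tau> + s) powr (-m-2)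
    - K * \<tau> powr (-m) * exp (- s / (4 * \<tau>)) / (4 * \<tau>)"

definition barrier_ss :: "real \<Rightarrow> real \<Rightarrow> real \<Rightarrow> real \<Rightarrow> real \<Rightarrow> real" where
  "barrier_ss m c K s \<tau> = m * (m + 1) * (\<tau> + s) powr (-m-2) + c * \<tau> * (m + 1) * (m + 2) * (\<tau> + s) powr (-m-3)
    + K * \<tau> powr (-m) * exp (- s / (4 * \<tau>)) / (16 * \<tau>\<^sup>2)"

definition barrier_t :: "real \<Rightarrow> real \<Rightarrow> real \<Rightarrow> real \<Rightarrow> real \<Rightarrow> real" where
  "barrier_t m c K s \<tau> = - m * (\<tau> + s) powr (-m-1) + c * (\<tau> + s) powr (-m-1) - c * \<tau> * (m + 1) * (\<tau> + s) powr (-m-2)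
    + K * \<tau> powr (-m) * exp (- s / (4 * \<tau>)) * (s / (4 * \<tau>\<^sup>2) - m / \<tau>)"

lemma powr_has_real_derivative:
  fixes g :: "real \<Rightarrow> real"
  assumes "(g has_real_derivative g') (at x)" "g x > 0"
  shows "((\<lambda>x. g x powr r) has_real_derivative r * g x powr (r - 1) * g') (at x)"
  using DERIV_fun_powr[OF assms] by simp

lemma barrier_s: "s \<ge> 0 \<Longrightarrow> \<tau> > 0 \<Longrightarrow> ((\<lambda>s. barrier m c K s \<tau>) has_real_derivative barrier_s m c K s \<tau>) (at s)"
  unfolding barrier_def barrier_s_def
  by (auto intro!: derivative_eq_intros powr_has_real_derivative simp: field_simps)

lemma barrier_ss: "s \<ge> 0 \<Longrightarrow> \<tau> > 0 \<Longrightarrow> ((\<lambda>s. barrier_s m c K s \<tau>) has_real_derivative barrier_ss m c K s \<tau>) (at s)"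
  unfolding barrier_s_def barrier_ss_def
  by (auto intro!: derivative_eq_intros powr_has_real_derivative simp: field_simps power2_eq_square)

lemma barrier_t: "s \<ge> 0 \<Longrightarrow> \<tau> > 0 \<Longrightarrow> ((\<lambda>\<tau>. barrier m c K s \<tau>) has_real_derivative barrier_t m c K s \<tau>) (at \<tau>)"
proof -
  assume s: "s \<ge> 0" and \<tau>: "\<tau> > 0"
  have "\<tau> powr (-m-1) = \<tau> powr (-m) / \<tau>"
    using \<tau> by (simp add: powr_diff)
  then show ?thesis
    unfolding barrier_def barrier_t_def using s \<tau>
    by (auto intro!: derivative_eq_intros powr_has_real_derivative simp: field_simps power2_eq_square)
qed

text \<open>For a function of s = |x|^2 the Laplacian in dimension N is 4 s times the second plus 2
  N times the first s-derivative. The constant \<open>c\<close> is chosen so that c - m - 4 m (m+1)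
  = 2: the second summand offsets the loss of the first and leaves a surplus.
  \<open>\<kappa>\<close> collects the losses c (m+1) + 4 c (m+1)(m+2) of the second summand, which
  carry a factor \<open>\<tau> / B\<close>.\<close>

lemma barrier_supersolution:
  fixes m N s \<tau> :: real
  defines "c \<equiv> m * (4 * m + 5) + 2"
  defines "\<kappa> \<equiv> c * ((m + 1) * (4 * m + 9))"
  assumes m: "0 < m" "m < N / 2" and s: "s \<ge> 0" and \<tau>: "\<tau> > 0"
    and K: "\<kappa> \<le> K * (N / 2 - m) * exp (- \<kappa> / 4)"
  shows "(\<tau> + s) powr (-m-1) \<le> barrier_t m c K s \<tau> - (4 * s * barrier_ss m c K s \<tau> + 2 * N * barrier_s m c K s \<tau>)"
proof -
  define B where "B = \<tau> + s"
  define p where "p = B powr (-m-1)"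
  define E where "E = K * \<tau> powr (-m) * exp (- s / (4 * \<tau>))"
  have B: "B > 0" "\<tau> \<le> B" "s \<le> B"
    using s \<tau> by (auto simp: B_def)
  have p: "p > 0"
    using B by (simp add: p_def)
  have "-m-2 = (-m-1) - 1" "-m-3 = (-m-1) - 2"
    by simp_all
  then have p2: "B powr (-m-2) = p / B" and p3: "B powr (-m-3) = p / B\<^sup>2"
    using B by (simp_all only: p_def powr_diff) (simp_all add: powr_numeral)
  have c: "c > 0" and \<kappa>: "\<kappa> > 0"
    using m by (auto simp: c_def \<kappa>_def add_pos_pos)
  \<comment> \<open>In the Gaussian summand the terms with s cancel exactly, leaving only E (N/2 -
    m)/\<open>\<tau>\<close>.\<close>
  have "barrier_t m c K s \<tau> - (4 * s * barrier_ss m c K s \<tau> + 2 * N * barrier_s m c K s \<tau>) =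
      p * (- m - 4 * m * (m + 1) * (s / B) + 2 * N * m) +
      p * (c - c * (m + 1) * (\<tau> / B) - 4 * c * (m + 1) * (m + 2) * (\<tau> / B) * (s / B) + 2 * N * c * (m + 1) * (\<tau> / B)) +
      E * (N / 2 - m) / \<tau>"
    unfolding barrier_t_def barrier_ss_def barrier_s_def B_def[symmetric] E_def[symmetric] p2 p3 p_def[symmetric]
    using B \<tau> by (simp add: field_simps power2_eq_square)
  moreover have "p * (- m - 4 * m * (m + 1)) \<le> p * (- m - 4 * m * (m + 1) * (s / B) + 2 * N * m)"
  proof -
    have "4 * m * (m + 1) * (s / B) \<le> 4 * m * (m + 1) * 1"
      using m B s by (intro mult_left_mono) auto
    moreover have "2 * N * m \<ge> 0"
      using m by simp
    ultimately have "- m - 4 * m * (m + 1) \<le> - m - 4 * m * (m + 1) * (s / B) + 2 * N * m"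
      by linarith
    then show ?thesis
      using p by simp
  qed
  moreover have "p * (c - \<kappa> * (\<tau> / B)) \<le>
      p * (c - c * (m + 1) * (\<tau> / B) - 4 * c * (m + 1) * (m + 2) * (\<tau> / B) * (s / B) + 2 * N * c * (m + 1) * (\<tau> / B))"
  proof -
    have 1: "4 * c * (m + 1) * (m + 2) * (\<tau> / B) * (s / B) \<le> 4 * c * (m + 1) * (m + 2) * (\<tau> / B) * 1"
      using m B s \<tau> c by (intro mult_left_mono) auto
    have 2: "2 * N * c * (m + 1) * (\<tau> / B) \<ge> 0"
      using m B \<tau> c by simp
    have 3: "\<kappa> * (\<tau> / B) = c * (m + 1) * (\<tau> / B) + 4 * c * (m + 1) * (m + 2) * (\<tau> / B) * 1"
      unfolding \<kappa>_def by algebra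
    have "k = u + y \<Longrightarrow> x \<le> y \<Longrightarrow> 0 \<le> v \<Longrightarrow> c - k \<le> c - u - x + v" for k u v x y :: real
      by linarith
    from this[OF 3 1 2] have "c - \<kappa> * (\<tau> / B) \<le>
        c - c * (m + 1) * (\<tau> / B) - 4 * c * (m + 1) * (m + 2) * (\<tau> / B) * (s / B) + 2 * N * c * (m + 1) * (\<tau> / B)" .
    then show ?thesis
      using p by simp
  qed
  moreover have "p * (- m - 4 * m * (m + 1)) + p * (c - \<kappa> * (\<tau> / B)) = p * (2 - \<kappa> * (\<tau> / B))"
    by (simp add: c_def algebra_simps)
  moreover have "p \<le> p * (2 - \<kappa> * (\<tau> / B)) + E * (N / 2 - m) / \<tau>"
  \<comment> \<open>In the outer region the losses are at most p and the surplus suffices. In the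
    inner region s/\<open>\<tau>\<close> is at most \<open>\<kappa>\<close>, so the Gaussian factor
    is at least exp(-\<open>\<kappa>\<close>/4) and the hypothesis on \<open>K\<close> pays for the
    loss \<open>\<kappa>\<close> p.\<close>
  proof (cases "\<kappa> * \<tau> \<le> B")
    case True
    then have "\<kappa> * (\<tau> / B) \<le> 1"
      using B by (simp add: field_simps)
    then have "p * 1 \<le> p * (2 - \<kappa> * (\<tau> / B))"
      using p by (intro mult_left_mono) auto
    moreover have "K \<ge> 0"
    proof (rule ccontr)
      assume "\<not> K \<ge> 0"
      then have "K * (N / 2 - m) * exp (- \<kappa> / 4) < 0"
        using m by (simp add: mult_neg_pos)
      with K \<kappa> show False
        by linarith
    qed
    then have "E * (N / 2 - m) / \<tau> \<ge> 0"
      using m \<tau> by (simp add: E_def)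
    ultimately show ?thesis
      by linarith
  next
    case False
    have "p * \<kappa> \<le> E * (N / 2 - m) / \<tau>"
    proof -
      have "s / \<tau> \<le> \<kappa>"
        using False B \<tau> by (simp add: field_simps)
      then have e: "exp (- \<kappa> / 4) \<le> exp (- s / (4 * \<tau>))"
        by (simp add: field_simps)
      have "p \<le> \<tau> powr (-m-1)"
        unfolding p_def using m \<tau> B by (intro powr_mono2') auto
      also have "\<tau> powr (-m-1) = \<tau> powr (-m) / \<tau>"
        using \<tau> by (simp add: powr_diff)
      finally have "p * \<kappa> \<le> \<tau> powr (-m) / \<tau> * (K * (N / 2 - m) * exp (- \<kappa> / 4))"
        using p K \<kappa> by (intro mult_mono) auto
      also have "\<dots> \<le> \<tau> powr (-m) / \<tau> * (K * (N / 2 - m) * exp (- s / (4 * \<tau>)))"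
      proof -
        have "0 < K * (N / 2 - m) * exp (- \<kappa> / 4)"
          using K \<kappa> by linarith
        then have "K * (N / 2 - m) \<ge> 0"
          using zero_less_mult_pos2[of "K * (N / 2 - m)" "exp (- \<kappa> / 4)"] by simp
        then show ?thesis
          using e \<tau> by (intro mult_left_mono) auto
      qed
      finally show ?thesis
        by (simp add: E_def mult_ac)
    qed
    moreover have "p * (2 - \<kappa>) \<le> p * (2 - \<kappa> * (\<tau> / B))"
    proof -
      have "\<kappa> * (\<tau> / B) \<le> \<kappa> * 1"
        using \<kappa> B by (intro mult_left_mono) auto
      then show ?thesis
        using p by simp
    qed
    ultimately show ?thesis
      using p by (simp add: algebra_simps)
  qed
  ultimately show ?thesis
    unfolding B_def[symmetric] p_def[symmetric] by linarith
qed

lemma barrier_lower: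
  assumes "c \<ge> 0" "K \<ge> 0" "\<tau> \<ge> 0"
  shows "(\<tau> + s) powr (-m) \<le> barrier m c K s \<tau>"
  using assms by (simp add: barrier_def)

text \<open>The Gaussian summand is the only one that needs work. With y = s/\<open>\<tau>\<close>
  the claim reduces to (1+y)^m exp(-y/4) <= (1+4m)^m.\<close>

lemma barrier_upper:
  assumes m: "m > 0" and c: "c \<ge> 0" and K: "K \<ge> 0" and s: "s \<ge> 0" and \<tau>: "\<tau> > 0"
  shows "barrier m c K s \<tau> \<le> (1 + c + K * (1 + 4 * m) powr m) * (\<tau> + s) powr (-m)"
proof -
  define B where "B = \<tau> + s"
  have B: "B > 0" "\<tau> \<le> B"
    using s \<tau> by (auto simp: B_def)
  have "c * \<tau> * B powr (-m-1) \<le> c * B powr (-m)"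
  proof -
    have "B powr (-m-1) = B powr (-m) / B"
      using B by (simp add: powr_diff)
    then have "B powr (-m) = B * B powr (-m-1)"
      using B by simp
    then have "\<tau> * B powr (-m-1) \<le> B powr (-m)"
      using B by (simp only:) (intro mult_right_mono, auto)
    then show ?thesis
      using c by (simp add: mult.assoc mult_left_mono)
  qed
  moreover have "\<tau> powr (-m) * exp (- s / (4 * \<tau>)) \<le> (1 + 4 * m) powr m * B powr (-m)"
  proof -
    define y where "y = s / \<tau>"
    have y: "y \<ge> 0"
      using s \<tau> by (simp add: y_def)
    \<comment> \<open>The scale 4m is chosen because exp(y/(4m)), which dominates the last factor,
      has m-th power exp(y/4).\<close>
    have "1 + y \<le> (1 + 4 * m) * (1 + y / (4 * m))"
    proof -
      have "(1 + 4 * m) * (1 + y / (4 * m)) = 1 + y + (4 * m + y / (4 * m))"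
        using m by (simp add: field_simps)
      moreover have "4 * m + y / (4 * m) \<ge> 0"
        using m y by simp
      ultimately show ?thesis
        by linarith
    qed
    also have "\<dots> \<le> (1 + 4 * m) * exp (y / (4 * m))"
      using m by (intro mult_left_mono exp_ge_add_one_self) auto
    finally have "(1 + y) powr m \<le> ((1 + 4 * m) * exp (y / (4 * m))) powr m"
      using m y by (intro powr_mono2) auto
    also have "\<dots> = (1 + 4 * m) powr m * exp (y / 4)"
      using m by (simp add: powr_mult exp_powr_real)
    finally have *: "(1 + y) powr m * exp (- (y / 4)) \<le> (1 + 4 * m) powr m"
      by (simp add: exp_minus field_simps)
    have "B = \<tau> * (1 + y)"
      using \<tau> by (simp add: B_def y_def field_simps)
    then have "B powr (-m) = \<tau> powr (-m) * (1 + y) powr (-m)"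
      using \<tau> y by (simp add: powr_mult)
    then have "\<tau> powr (-m) = B powr (-m) * (1 + y) powr m"
      using y by (simp add: powr_minus field_simps)
    then have "\<tau> powr (-m) * exp (- s / (4 * \<tau>)) = B powr (-m) * ((1 + y) powr m * exp (- (y / 4)))"
      by (simp add: y_def mult.commute[of \<tau>])
    also have "\<dots> \<le> B powr (-m) * (1 + 4 * m) powr m"
      using * by (intro mult_left_mono) auto
    finally show ?thesis
      by (simp add: mult.commute)
  qed
  then have "K * (\<tau> powr (-m) * exp (- s / (4 * \<tau>))) \<le> K * ((1 + 4 * m) powr m * B powr (-m))"
    using K by (rule mult_left_mono)
  ultimately show ?thesis
    unfolding barrier_def B_def[symmetric] by (simp add: algebra_simps)
qed

lemma norm_sq_line_derivative:
  fixes x e :: "'a::real_inner"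
  shows "((\<lambda>a. (norm (x + a *\<^sub>R e))\<^sup>2) has_real_derivative 2 * (x \<bullet> e)) (at 0)"
proof -
  have "(norm (x + a *\<^sub>R e))\<^sup>2 = x \<bullet> x + 2 * a * (x \<bullet> e) + a\<^sup>2 * (e \<bullet> e)" for a
    unfolding power2_norm_eq_inner
    by (simp add: inner_add_left inner_add_right inner_commute[of e x] power2_eq_square algebra_simps)
  then show ?thesis
    by (auto intro!: derivative_eq_intros)
qed

section \<open>Superlinear nonlinearities\<close>

locale superlinear =
  fixes f f' f'' :: "real \<Rightarrow> real"
  assumes f_C1: "\<And>u. u \<ge> 0 \<Longrightarrow> (f has_real_derivative f' u) (at u within {0..})"
    and f'_cont: "continuous_on {0..} f'"
    and f_C2: "\<And>u. u > 0 \<Longrightarrow> (f' has_real_derivative f'' u) (at u)"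
    and f_0: "f 0 = 0"
    and f_pos: "\<And>u. u > 0 \<Longrightarrow> f u > 0"
    and f''_pos: "\<And>u. u > 0 \<Longrightarrow> f'' u > 0"
    and F_finite: "\<And>u. u > 0 \<Longrightarrow> set_integrable lborel {u..} (\<lambda>s. 1 / f s)"
begin

section \<open>Convexity of \<open>f\<close>, and \<open>F\<close> as a decreasing bijection\<close>

lemma f_deriv: "u > 0 \<Longrightarrow> (f has_real_derivative f' u) (at u)"
  using f_C1[of u] at_within_interior[of u "{0..}"] by (simp add: interior_real_atLeast)

lemma f_cont: "continuous_on {0<..} f"
  by (intro continuous_at_imp_continuous_on ballI DERIV_isCont[OF f_deriv]) auto

lemma f'_less: "0 < a \<Longrightarrow> a < b \<Longrightarrow> f' a < f' b"
proof -
  assume ab: "0 < a" "a < b"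
  show ?thesis
  proof (rule DERIV_pos_imp_increasing[OF ab(2)])
    fix x assume "a \<le> x" "x \<le> b"
    then show "\<exists>y. (f' has_real_derivative y) (at x) \<and> y > 0"
      using ab f_C2[of x] f''_pos[of x] by (intro exI[of _ "f'' x"]) auto
  qed
qed

text \<open>Since f(0) = 0, the slope of the chord from 0 to u is a value of \<open>f'\<close> at an
  intermediate point, and \<open>f'\<close> increases.\<close>

lemma f_le: "u > 0 \<Longrightarrow> f u \<le> u * f' u"
proof -
  assume u: "u > 0"
  have "continuous_on {0..u} f"
    by (rule continuous_on_subset[OF DERIV_continuous_on[OF f_C1]]) auto
  then obtain l z where z: "0 < z" "z < u" "DERIV f z :> l" "f u - f 0 = (u - 0) * l"
    using MVT[OF u, of f] f_deriv real_differentiable_def by blast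
  then have "l = f' z"
    using DERIV_unique f_deriv by blast
  with z u f'_less[of z u] show ?thesis
    by (simp add: f_0)
qed

lemma f'_pos: "u > 0 \<Longrightarrow> f' u > 0"
  using f_le[of u] f_pos[of u] by (metis less_le_trans zero_less_mult_pos)

lemma inverse_f_cont: "0 < a \<Longrightarrow> continuous_on {a..b} (\<lambda>s. 1 / f s)"
proof -
  assume "0 < a"
  then have "\<forall>s\<in>{a..b}. f s \<noteq> 0"
    using f_pos by (metis atLeastAtMost_iff less_irrefl less_le_trans)
  moreover have "continuous_on {a..b} f"
    by (rule continuous_on_subset[OF f_cont]) (use \<open>0 < a\<close> in auto)
  ultimately show ?thesis
    by (intro continuous_intros)
qed

lemma F_split: "0 < a \<Longrightarrow> a \<le> b \<Longrightarrow> F_of f a = integral {a..b} (\<lambda>s. 1 / f s) + F_of f b"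
proof -
  assume ab: "0 < a" "a \<le> b"
  have F: "F_of f u = integral {u..} (\<lambda>s. 1 / f s)" "(\<lambda>s. 1 / f s) integrable_on {u..}" if "u > 0" for u
    unfolding F_of_def using set_borel_integral_eq_integral[OF F_finite[OF that]] by auto
  have Un: "{a..b} \<union> {b..} = {a..}" and Int: "{a..b} \<inter> {b..} = {b}"
    using ab by auto
  have "integral ({a..b} \<union> {b..}) (\<lambda>s. 1 / f s) = integral {a..b} (\<lambda>s. 1 / f s) + integral {b..} (\<lambda>s. 1 / f s)"
    by (rule Henstock_Kurzweil_Integration.integral_Un)
      (use ab F(2)[of b] in \<open>auto simp: Int intro!: integrable_continuous_real inverse_f_cont\<close>)
  then show ?thesis
    using ab F(1)[of a] F(1)[of b] by (simp add: Un)
qed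

lemma F_deriv: "u > 0 \<Longrightarrow> (F_of f has_real_derivative - (1 / f u)) (at u)"
proof -
  assume u: "u > 0"
  let ?a = "u / 2" and ?b = "u + 1"
  have "((\<lambda>x. integral {?a..x} (\<lambda>s. 1 / f s)) has_real_derivative 1 / f u) (at u within {?a..?b})"
    by (rule integral_has_real_derivative) (use u in \<open>auto intro!: inverse_f_cont\<close>)
  then have "((\<lambda>x. F_of f ?a - integral {?a..x} (\<lambda>s. 1 / f s)) has_real_derivative 0 - 1 / f u) (at u)"
    using u at_within_interior[of u "{?a..?b}"] by (intro DERIV_diff DERIV_const) simp
  then have "((\<lambda>x. F_of f ?a - integral {?a..x} (\<lambda>s. 1 / f s)) has_real_derivative - (1 / f u)) (at u)"
    by simp
  moreover have "F_of f ?a - integral {?a..x} (\<lambda>s. 1 / f s) = F_of f x" if "?a < x" for x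
    using F_split[of ?a x] u that by simp
  ultimately show ?thesis
    by (elim has_field_derivative_transform_within_open[where S = "{?a<..}"]) (use u in auto)
qed

lemma F_less: "0 < a \<Longrightarrow> a < b \<Longrightarrow> F_of f b < F_of f a"
proof -
  assume ab: "0 < a" "a < b"
  show ?thesis
  proof (rule DERIV_neg_imp_decreasing[OF ab(2)])
    fix x assume "a \<le> x" "x \<le> b"
    then show "\<exists>y. (F_of f has_real_derivative y) (at x) \<and> y < 0"
      using ab F_deriv[of x] f_pos[of x] by (intro exI[of _ "- (1 / f x)"]) auto
  qed
qed

lemma F_pos: "u > 0 \<Longrightarrow> F_of f u > 0"
proof -
  assume u: "u > 0"
  have "F_of f (u + 1) \<ge> 0"
    unfolding F_of_def set_lebesgue_integral_def
    using u f_pos by (intro integral_nonneg_AE AE_I2) (auto simp: indicator_def less_imp_le)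
  with F_less[of u "u + 1"] u show ?thesis
    by simp
qed

lemma F_less_iff: "0 < a \<Longrightarrow> 0 < b \<Longrightarrow> F_of f b < F_of f a \<longleftrightarrow> a < b"
  using F_less[of a b] F_less[of b a] by (cases a b rule: linorder_cases) auto

lemma F_small: "e > 0 \<Longrightarrow> \<exists>u>0. F_of f u < e"
proof -
  assume e: "e > 0"
  have int: "integrable lborel (\<lambda>s. indicator {1..} s *\<^sub>R (1 / f s))"
    using F_finite[of 1] by (simp add: set_integrable_def)
  have "(\<lambda>n. \<integral>s. indicator {real n + 1..} s *\<^sub>R (1 / f s) \<partial>lborel) \<longlonglongrightarrow> (\<integral>s. 0 \<partial>(lborel :: real measure))"
  proof (rule integral_dominated_convergence[OF _ _ int])
    show "AE s in lborel. (\<lambda>n. indicator {real n + 1..} s *\<^sub>R (1 / f s)) \<longlonglongrightarrow> 0"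
    proof (rule AE_I2, rule tendsto_eventually)
      fix s :: real
      obtain n0 where "s < real n0"
        using reals_Archimedean2 by blast
      then have "\<forall>n\<ge>n0. indicator {real n + 1..} s *\<^sub>R (1 / f s) = 0"
        by (auto simp: indicator_def)
      then show "\<forall>\<^sub>F n in sequentially. indicator {real n + 1..} s *\<^sub>R (1 / f s) = 0"
        unfolding eventually_sequentially by blast
    qed
    show "AE s in lborel. norm (indicator {real n + 1..} s *\<^sub>R (1 / f s)) \<le> indicator {1..} s *\<^sub>R (1 / f s)" for n
      using f_pos by (intro AE_I2) (auto simp: indicator_def less_imp_le)
    show "(\<lambda>s. indicator {real n + 1..} s *\<^sub>R (1 / f s)) \<in> borel_measurable lborel" for n
      using F_finite[of "real n + 1"] unfolding set_integrable_def by (intro borel_measurable_integrable) simp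
  qed simp
  then have "(\<lambda>n. F_of f (real n + 1)) \<longlonglongrightarrow> 0"
    by (simp add: F_of_def set_lebesgue_integral_def)
  from order_tendstoD(2)[OF this e] obtain n where "F_of f (real n + 1) < e"
    unfolding eventually_sequentially by blast
  then show ?thesis
    by (intro exI[of _ "real n + 1"]) auto
qed

text \<open>Near zero \<open>f\<close> is at most linear, so \<open>F\<close> dominates a multiple of \<open>- ln u\<close>.\<close>

lemma F_large: "\<exists>u>0. v < F_of f u"
proof -
  let ?K = "f' 1"
  have K: "?K > 0"
    by (rule f'_pos) simp
  define u where "u = min 1 (exp (- ?K * v))"
  have u: "0 < u" "u \<le> 1"
    by (auto simp: u_def)
  \<comment> \<open>On (0,1] one has f(x) <= x f'(1), so F + ln / f'(1) is nonincreasing there; the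
    choice of \<open>u\<close> makes -ln u / f'(1) at least \<open>v\<close>.\<close>
  have "F_of f 1 + ln 1 / ?K \<le> F_of f u + ln u / ?K"
  proof (rule DERIV_nonpos_imp_nonincreasing[OF u(2)])
    fix x assume x: "u \<le> x" "x \<le> 1"
    then have x0: "x > 0"
      using u by simp
    have "f' x \<le> ?K"
      using f'_less[of x 1] x x0 by (cases "x = 1") auto
    then have "x * f' x \<le> x * ?K"
      using x0 by simp
    with f_le[OF x0] have "f x \<le> x * ?K"
      by linarith
    then have "1 / (x * ?K) \<le> 1 / f x"
      using x0 K f_pos by (intro divide_left_mono) auto
    moreover have "((\<lambda>x. F_of f x + ln x / ?K) has_real_derivative - (1 / f x) + 1 / x / ?K) (at x)"
      using x0 K by (intro DERIV_add F_deriv DERIV_cdivide DERIV_ln_divide) auto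
    ultimately show "\<exists>y. ((\<lambda>x. F_of f x + ln x / ?K) has_real_derivative y) (at x) \<and> y \<le> 0"
      by (intro exI[of _ "- (1 / f x) + 1 / x / ?K"]) simp
  qed
  moreover have "ln u \<le> - ?K * v"
  proof -
    have "ln u \<le> ln (exp (- ?K * v))"
      using u by (subst ln_le_cancel_iff) (auto simp: u_def)
    then show ?thesis
      by simp
  qed
  then have "ln u / ?K \<le> - v"
    using K by (simp add: field_simps)
  ultimately have "F_of f u > v"
    using F_pos[of 1] by simp
  with u show ?thesis
    by blast
qed

lemma F_inj: "inj_on (F_of f) {0<..}"
  by (rule inj_onI) (metis F_less greaterThan_iff less_irrefl linorder_neqE_linordered_idom)

lemma F_surj: "v > 0 \<Longrightarrow> v \<in> F_of f ` {0<..}"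
proof -
  assume v: "v > 0"
  obtain a where a: "a > 0" "v < F_of f a"
    using F_large by blast
  obtain b where b: "b > 0" "F_of f b < v"
    using F_small[OF v] by blast
  then have "a < b"
    using F_less_iff[of a b] a b by simp
  moreover have "isCont (F_of f) x" if "a \<le> x" for x
    using that a by (intro DERIV_isCont[OF F_deriv]) simp
  ultimately obtain x where "a \<le> x" "F_of f x = v"
    using IVT2[of "F_of f" b v a] a b by (metis less_imp_le)
  with a show ?thesis
    by (intro image_eqI[of _ _ x]) auto
qed

lemma F_inv_pos: "v > 0 \<Longrightarrow> F_inv f v > 0"
  using inv_into_into[OF F_surj] by (simp add: F_inv_def)

lemma F_F_inv: "v > 0 \<Longrightarrow> F_of f (F_inv f v) = v"
  unfolding F_inv_def by (rule f_inv_into_f[OF F_surj])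

lemma F_inv_F: "u > 0 \<Longrightarrow> F_inv f (F_of f u) = u"
  unfolding F_inv_def by (rule inv_into_f_f[OF F_inj]) simp

lemma F_inv_less: "0 < a \<Longrightarrow> a < b \<Longrightarrow> F_inv f b < F_inv f a"
  using F_less_iff[of "F_inv f b" "F_inv f a"] by (simp add: F_F_inv F_inv_pos)

lemma F_inv_le: "0 < a \<Longrightarrow> a \<le> b \<Longrightarrow> F_inv f b \<le> F_inv f a"
  using F_inv_less[of a b] by (cases "a = b") auto

lemma F_inv_isCont: "v > 0 \<Longrightarrow> isCont (F_inv f) v"
proof -
  assume v: "v > 0"
  let ?u = "F_inv f v"
  have "isCont (F_inv f) (F_of f ?u)"
  proof (rule isCont_inverse_function[where f = "F_of f" and x = ?u and d = "?u / 2"])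
    fix z
    assume "\<bar>z - ?u\<bar> \<le> ?u / 2"
    then have "z > 0"
      using F_inv_pos[OF v] by linarith
    then show "F_inv f (F_of f z) = z"
      by (rule F_inv_F)
    show "isCont (F_of f) z"
      by (rule DERIV_isCont[OF F_deriv[OF \<open>z > 0\<close>]])
  qed (use F_inv_pos[OF v] in simp)
  then show ?thesis
    by (simp add: F_F_inv[OF v])
qed

lemma F_inv_cont: "continuous_on {0<..} (F_inv f)"
  by (intro continuous_at_imp_continuous_on ballI F_inv_isCont) auto

lemma F_inv_deriv: "v > 0 \<Longrightarrow> (F_inv f has_real_derivative - f (F_inv f v)) (at v)"
proof -
  assume v: "v > 0"
  note u = F_inv_pos[OF v]
  have "(F_inv f has_real_derivative inverse (- (1 / f (F_inv f v)))) (at v)"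
  proof (rule DERIV_inverse_function[where f = "F_of f" and a = 0 and b = "v + 1"])
    show "(F_of f has_real_derivative - (1 / f (F_inv f v))) (at (F_inv f v))"
      by (rule F_deriv[OF u])
    show "- (1 / f (F_inv f v)) \<noteq> 0"
      using f_pos[OF u] by simp
    show "isCont (F_inv f) v"
      by (rule F_inv_isCont[OF v])
  qed (use v F_F_inv in auto)
  then show ?thesis
    by simp
qed

text \<open>Applied to (1 + |x|^2)^(-m) it returns the initial value with A =
  1/\<open>\<gamma>\<close>. It is increasing in w, as a composition of two decreasing maps.\<close>

definition transform :: "real \<Rightarrow> real \<Rightarrow> real \<Rightarrow> real" where
  "transform A m w = F_inv f (A * w powr (- (1 / m)))"

definition transform' :: "real \<Rightarrow> real \<Rightarrow> real \<Rightarrow> real" where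
  "transform' A m w = f (transform A m w) * (A / m) * w powr (- (1 / m) - 1)"

text \<open>With u = \<open>transform A m w\<close> one has F(u) = A w^(-1/m), so the bracket is
  f'(u) F(u) - (m+1): concavity is exactly the bound obtained from the limit
  \<open>q\<close>.\<close>

definition transform'' :: "real \<Rightarrow> real \<Rightarrow> real \<Rightarrow> real" where
  "transform'' A m w = f (transform A m w) * (A / m\<^sup>2) * w powr (- (1 / m) - 2) *
    (f' (transform A m w) * (A * w powr (- (1 / m))) - (m + 1))"

lemma transform_pos: "A > 0 \<Longrightarrow> w > 0 \<Longrightarrow> transform A m w > 0"
  by (simp add: transform_def F_inv_pos)

lemma transform_deriv:
  assumes "A > 0" "m > 0" "w > 0"
  shows "(transform A m has_real_derivative transform' A m w) (at w)"
proof -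
  have "((\<lambda>w. A * w powr (- (1 / m))) has_real_derivative A * (- (1 / m) * w powr (- (1 / m) - 1) * 1)) (at w)"
    using assms by (intro DERIV_cmult powr_has_real_derivative) auto
  from DERIV_chain2[OF F_inv_deriv this] show ?thesis
    using assms unfolding transform_def transform'_def by (simp add: mult_ac)
qed

lemma transform'_deriv:
  assumes "A > 0" "m > 0" "w > 0"
  shows "(transform' A m has_real_derivative transform'' A m w) (at w)"
proof -
  let ?p = "w powr (- (1 / m))"
  have p: "w powr (- (1 / m) - 1) = ?p / w" "w powr (- (1 / m) - 1 - 1) = ?p / w\<^sup>2" "w powr (- (1 / m) - 2) = ?p / w\<^sup>2"
    using assms(3) by (simp_all only: powr_diff) (simp_all add: powr_numeral power2_eq_square)
  have "((\<lambda>w. w powr (- (1 / m) - 1)) has_real_derivative (- (1 / m) - 1) * w powr (- (1 / m) - 1 - 1) * 1) (at w)"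
    using assms by (intro powr_has_real_derivative) auto
  moreover have "((\<lambda>w. f (transform A m w)) has_real_derivative f' (transform A m w) * transform' A m w) (at w)"
    by (rule DERIV_chain2[OF f_deriv[OF transform_pos] transform_deriv]) (use assms in auto)
  ultimately have "((\<lambda>w. f (transform A m w) * (A / m) * w powr (- (1 / m) - 1)) has_real_derivative
      f' (transform A m w) * transform' A m w * (A / m) * w powr (- (1 / m) - 1) +
      (- (1 / m) - 1) * w powr (- (1 / m) - 1 - 1) * 1 * (f (transform A m w) * (A / m))) (at w)"
    by (intro DERIV_mult DERIV_cmult_right)
  moreover have "f' (transform A m w) * transform' A m w * (A / m) * w powr (- (1 / m) - 1) +
      (- (1 / m) - 1) * w powr (- (1 / m) - 1 - 1) * 1 * (f (transform A m w) * (A / m)) = transform'' A m w"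
    unfolding transform'_def transform''_def p using assms by (simp add: field_simps power2_eq_square)
  ultimately show ?thesis
    unfolding transform'_def[abs_def] by simp
qed

text \<open>Outside \<open>[0, M]\<close> the nonlinearity may be changed freely, since the solution will stay in \<open>[0, M]\<close>.\<close>

lemma lipschitz_extension:
  assumes M: "M > 0"
  obtains g g' L where "g 0 = 0" "\<And>y. (g has_real_derivative g' y) (at y)" "continuous_on UNIV g'"
    "\<And>y. \<bar>g' y\<bar> \<le> L" "\<And>y. 0 \<le> y \<Longrightarrow> y \<le> M \<Longrightarrow> g y = f y"
proof -
  \<comment> \<open>Freezing the derivative rather than the function outside [0,M] keeps the
    extension continuously differentiable with a bounded derivative.\<close>
  define g' where "g' y = f' (max 0 (min M y))" for y
  have g': "continuous_on UNIV g'"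
    unfolding g'_def using M by (intro continuous_on_compose2[OF f'_cont] continuous_intros) auto
  have "bounded (f' ` {0..M})"
    by (intro compact_imp_bounded compact_continuous_image continuous_on_subset[OF f'_cont]) auto
  then obtain L where "\<forall>y\<in>{0..M}. \<bar>f' y\<bar> \<le> L"
    unfolding bounded_iff by auto
  then have L: "\<bar>g' y\<bar> \<le> L" for y
    using M by (auto simp: g'_def)
  obtain P where P: "\<And>x. (P has_real_derivative g' x) (at x)"
    using continuous_antiderivative[OF g'] by blast
  define g where "g y = P y - P 0" for y
  have g: "(g has_real_derivative g' y) (at y)" for y
    unfolding g_def using DERIV_diff[OF P DERIV_const] by simp
  have "g y = f y" if y: "0 \<le> y" "y \<le> M" for y
  proof -
    have "\<exists>c. \<forall>u\<in>{0..M}. g u - f u = c"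
    proof (rule has_field_derivative_zero_constant)
      fix u assume u: "u \<in> {0..M}"
      have "(g has_real_derivative f' u) (at u within {0..M})"
        using has_field_derivative_at_within[OF g[of u]] u by (simp add: g'_def)
      moreover have "(f has_real_derivative f' u) (at u within {0..M})"
        by (rule DERIV_subset[OF f_C1]) (use u in auto)
      ultimately show "((\<lambda>u. g u - f u) has_real_derivative 0) (at u within {0..M})"
        using DERIV_diff by fastforce
    qed auto
    then have "g y - f y = g 0 - f 0"
      using y M by force
    then show ?thesis
      by (simp add: g_def f_0)
  qed
  with g g' L show ?thesis
    using that[of g g' L] by (simp add: g_def)
qed

lemma initial_gradient:
  fixes x e :: "'a::euclidean_space"
  assumes A: "A > 0"
  shows "((\<lambda>a. F_inv f (A * ((norm (x + a *\<^sub>R e))\<^sup>2 + 1))) has_real_derivative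
    (- (2 * A * f (F_inv f (A * ((norm x)\<^sup>2 + 1)))) *\<^sub>R x) \<bullet> e) (at 0)"
proof -
  have "((\<lambda>a. A * ((norm (x + a *\<^sub>R e))\<^sup>2 + 1)) has_real_derivative A * (2 * (x \<bullet> e))) (at 0)"
    using DERIV_cmult[OF DERIV_add[OF norm_sq_line_derivative[of x e] DERIV_const[of 1]], of A] by simp
  moreover have "A * ((norm (x + 0 *\<^sub>R e))\<^sup>2 + 1) > 0"
    using A by (simp add: add_nonneg_pos)
  ultimately show ?thesis
    using DERIV_chain2[OF F_inv_deriv] by (fastforce simp: mult_ac)
qed

text \<open>With u the initial value at x and v = F(u), the estimates 2|x| <= |x|^2 + 1 and f(u) <=
  u f'(u) bound the norm by u f'(u) v, hence by (m+1) u.\<close>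

lemma initial_gradient_bound:
  fixes x :: "'a::euclidean_space"
  assumes A: "A > 0" and m: "m > 0"
    and v: "f' (F_inv f (A * ((norm x)\<^sup>2 + 1))) * (A * ((norm x)\<^sup>2 + 1)) \<le> m + 1"
  shows "norm (- (2 * A * f (F_inv f (A * ((norm x)\<^sup>2 + 1)))) *\<^sub>R x) \<le> (m + 1) * F_inv f A"
proof -
  let ?v = "A * ((norm x)\<^sup>2 + 1)"
  let ?u = "F_inv f ?v"
  have v_pos: "?v > 0"
    using A by (simp add: add_nonneg_pos)
  then have u: "?u > 0"
    by (rule F_inv_pos)
  have "0 \<le> (norm x - 1)\<^sup>2"
    by simp
  then have x: "2 * norm x \<le> (norm x)\<^sup>2 + 1"
    by (simp add: power2_eq_square algebra_simps)
  have "norm (- (2 * A * f ?u) *\<^sub>R x) = f ?u * (A * (2 * norm x))"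
    using A f_pos[OF u] by simp
  also have "\<dots> \<le> (?u * f' ?u) * (A * ((norm x)\<^sup>2 + 1))"
    using A x u f_le[OF u] f'_pos[OF u] by (intro mult_mono mult_left_mono) auto
  also have "\<dots> = ?u * (f' ?u * ?v)"
    by simp
  also have "\<dots> \<le> F_inv f A * (m + 1)"
    using v u f'_pos[OF u] v_pos F_inv_pos[OF A] A m
    by (intro mult_mono F_inv_le) (auto simp: mult_le_cancel_left1 intro!: mult_nonneg_nonneg)
  finally show ?thesis
    by (simp add: mult.commute)
qed

text \<open>\<open>v0\<close> expresses the bound f'(u) F(u) <= m+1 for small u in the variable v =
  F(u), where small u means large v.\<close>

lemma global_solution_exists:
  assumes m: "0 < m" "m < real CARD('n::finite) / 2"
    and v0: "\<And>v. v > v0 \<Longrightarrow> v > 0 \<Longrightarrow> f' (F_inv f v) * v \<le> m + 1"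
  shows "\<exists>A0>0. \<forall>A>A0. \<exists>u :: real ^ 'n \<Rightarrow> real \<Rightarrow> real.
    global_solution f (\<lambda>x. F_inv f (A * ((norm x)\<^sup>2 + 1))) u"
proof -
  define N where "N = real CARD('n)"
  define c where "c = m * (4 * m + 5) + 2"
  define \<kappa> where "\<kappa> = c * ((m + 1) * (4 * m + 9))"
  \<comment> \<open>This gives equality in the hypothesis on \<open>K\<close> of
    \<open>barrier_supersolution\<close>; m < N/2 makes it positive.\<close>
  define K where "K = \<kappa> * exp (\<kappa> / 4) / (N / 2 - m)"
  define D where "D = 1 + c + K * (1 + 4 * m) powr m"
  \<comment> \<open>The entries make A positive, bring the initial values and then all values of the
    supersolution into the range beyond \<open>v0\<close>, and make A D^(-1/m-1)/m at least 1 in the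
    final inequality.\<close>
  define A0 where "A0 = Max {1, v0, v0 * D powr (1 / m), m * D powr (1 / m + 1)}"
  have "\<exists>u. global_solution f u0 u" if "A > A0" and u0: "\<And>x. u0 x = F_inv f (A * ((norm x)\<^sup>2 + 1))"
    for A and u0 :: "real ^ 'n \<Rightarrow> real"
  proof -
    have A: "A > 0" "A > v0" "A > v0 * D powr (1 / m)" "A > m * D powr (1 / m + 1)"
      using \<open>A > A0\<close> by (auto simp: A0_def)
    note m = m[folded N_def]
    have c: "c > 0" and \<kappa>: "\<kappa> > 0"
      using m by (auto simp: c_def \<kappa>_def add_pos_pos)
    have K: "K > 0" "\<kappa> \<le> K * (N / 2 - m) * exp (- \<kappa> / 4)"
      using m \<kappa> by (auto simp: K_def exp_minus field_simps)
    have D: "D \<ge> 1"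
      using c K m by (simp add: D_def add_nonneg_nonneg)
    \<comment> \<open>Since the barrier is at most \<open>D\<close>, this bounds F of the
      supersolution from below, and \<open>M\<close> bounds the supersolution from above.\<close>
    define vmin where "vmin = A * D powr (- (1 / m))"
    define M where "M = F_inv f vmin"
    have vmin: "vmin > 0" "vmin > v0"
      using A D by (auto simp: vmin_def powr_minus field_simps)
    have M: "M > 0"
      unfolding M_def by (rule F_inv_pos[OF vmin(1)])
    obtain g g' L where g0: "g 0 = 0" and g: "\<And>y. (g has_real_derivative g' y) (at y)"
      and g'_cont: "continuous_on UNIV g'" and L: "\<And>y. \<bar>g' y\<bar> \<le> L"
      and g_eq: "\<And>y. 0 \<le> y \<Longrightarrow> y \<le> M \<Longrightarrow> g y = f y"
      using lipschitz_extension[OF M] by metis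
    have L0: "L \<ge> 0"
      using L[of 0] by simp
    have lip: "\<bar>g y - g z\<bar> \<le> L * \<bar>y - z\<bar>" for y z
      using field_differentiable_bound[of UNIV g g' L y z] g L by auto
    define k0 where "k0 x = - (2 * A * f (u0 x)) *\<^sub>R x" for x
    have v_ge: "A * ((norm x)\<^sup>2 + 1) \<ge> A" "A * ((norm x)\<^sup>2 + 1) > 0" for x :: "real ^ 'n"
      using A(1) by (auto simp: add_nonneg_pos)
    have u0_pos: "u0 x > 0" for x
      unfolding u0 by (rule F_inv_pos[OF v_ge(2)])
    have u0_cont: "continuous_on UNIV u0"
      unfolding u0[abs_def] using v_ge(2)
      by (intro continuous_on_compose2[OF F_inv_cont] continuous_intros) auto
    obtain w where w: "tame w" and C21: "C21 w" and w_init: "\<And>x. w x 0 = u0 x"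
      and pde: "\<And>x t. t > 0 \<Longrightarrow> deriv (\<lambda>s. w x s) t = laplacian (\<lambda>y. w y t) x + g (w x t)"
    proof (rule semilinear_heat_solution[OF g0 g g'_cont L u0_cont, of "F_inv f A" k0 "(m + 1) * F_inv f A"])
      show "\<bar>u0 x\<bar> \<le> F_inv f A" for x
        using u0_pos[of x] F_inv_le[OF A(1) v_ge(1)[of x]] by (simp add: u0)
      show "continuous_on UNIV k0"
        unfolding k0_def[abs_def] using u0_pos
        by (intro continuous_intros continuous_on_compose2[OF f_cont u0_cont]) auto
      show "norm (k0 x) \<le> (m + 1) * F_inv f A" for x
        unfolding k0_def u0
        by (rule initial_gradient_bound[OF A(1) m(1) v0[OF less_le_trans[OF A(2) v_ge(1)] v_ge(2)]])
      show "((\<lambda>a. u0 (x + a *\<^sub>R e)) has_real_derivative k0 x \<bullet> e) (at 0)" for x e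
        unfolding k0_def u0 by (rule initial_gradient[OF A(1)])
    qed (rule that)
    have w_cont: "continuous_on (UNIV \<times> {0..}) (\<lambda>(x, t). w x t)"
      using tame_cont[OF w] continuous_on_subset by blast
    have w_bounded: "\<exists>C. \<forall>x. \<forall>t\<in>{0..T}. \<bar>w x t\<bar> \<le> C" for T
      using tame_bound[OF w, of T] by (metis atLeastAtMost_iff real_norm_def)
    define w1 where "w1 i x t = partial_deriv i (\<lambda>y. w y t) x" for i x t
    define w2 where "w2 i x t = partial_deriv i (partial_deriv i (\<lambda>y. w y t)) x" for i x t
    have w1: "((\<lambda>a. w (x + a *\<^sub>R axis i 1) t) has_real_derivative w1 i x t) (at 0)" if "t > 0" for i x t
      using C21 that unfolding C21_def partial_differentiable_def w1_def partial_deriv_def DERIV_deriv_iff_field_differentiable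
      by blast
    have w2: "((\<lambda>a. w1 i (x + a *\<^sub>R axis i 1) t) has_real_derivative w2 i x t) (at 0)" if "t > 0" for i x t
    proof -
      have "partial_differentiable i (partial_deriv i (\<lambda>y. w y t)) x"
        using C21 that unfolding C21_def by blast
      then show ?thesis
        unfolding partial_differentiable_def w1_def w2_def partial_deriv_def[of i "partial_deriv i (\<lambda>y. w y t)"]
          DERIV_deriv_iff_field_differentiable .
    qed
    have wt: "((\<lambda>s. w x s) has_real_derivative (\<Sum>i\<in>UNIV. w2 i x t) + g (w x t)) (at t)" if "t > 0" for x t
    proof -
      have "(\<lambda>s. w x s) field_differentiable at t"
        using C21 that unfolding C21_def by blast
      then show ?thesis
        using pde[OF that, of x] by (simp add: DERIV_deriv_iff_field_differentiable[symmetric] laplacian_def w2_def)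
    qed
    \<comment> \<open>Comparison with the zero solution: where w < 0, the Lipschitz bound and g(0) =
      0 give g(w) >= L w.\<close>
    have w_nonneg: "w x t \<ge> 0" if "t \<ge> 0" for x t
    proof (rule comparison_principle[OF L0 w_cont _ _ w1 w2 wt _ that])
      show "\<exists>C. \<forall>x. \<forall>t\<in>{0..T}. C \<le> w x t" for T
      proof -
        obtain C where "\<forall>x. \<forall>t\<in>{0..T}. \<bar>w x t\<bar> \<le> C"
          using w_bounded by blast
        then have "\<forall>x. \<forall>t\<in>{0..T}. - C \<le> w x t"
          by (simp add: abs_le_iff minus_le_iff)
        then show ?thesis
          by blast
      qed
      show "w x 0 \<ge> 0" for x
        using u0_pos[of x] by (simp add: w_init)
      show "L * w x t \<le> (\<Sum>i\<in>UNIV. w2 i x t) + g (w x t) - (\<Sum>i\<in>UNIV. w2 i x t)" if "w x t < 0" for x t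
        using lip[of "w x t" 0] that by (simp add: g0 abs_le_iff)
    qed
    define W where "W x t = barrier m c K ((norm x)\<^sup>2) (1 + t)" for x :: "real ^ 'n" and t
    define ub where "ub x t = transform A m (W x t)" for x t
    have W_lower: "((1 + t) + (norm x)\<^sup>2) powr (-m) \<le> W x t" if "t \<ge> 0" for x t
      unfolding W_def using c K that by (intro barrier_lower) auto
    have W_upper: "W x t \<le> D * ((1 + t) + (norm x)\<^sup>2) powr (-m)" if "t \<ge> 0" for x t
      unfolding W_def D_def using c K m that by (intro barrier_upper) auto
    have B1: "(1 + t) + (norm x)\<^sup>2 \<ge> 1" if "t \<ge> 0" for t and x :: "real ^ 'n"
      using that by simp
    have W_pos: "W x t > 0" if "t \<ge> 0" for x t
      using W_lower[OF that, of x] B1[OF that, of x] by (intro less_le_trans[OF _ W_lower[OF that]]) simp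
    have W_le_D: "W x t \<le> D" if "t \<ge> 0" for x t
    proof -
      have "((1 + t) + (norm x)\<^sup>2) powr (-m) \<le> 1"
        using powr_mono2'[of "-m" 1 "(1 + t) + (norm x)\<^sup>2"] B1[OF that, of x] m by simp
      then have "D * ((1 + t) + (norm x)\<^sup>2) powr (-m) \<le> D * 1"
        using D by (intro mult_left_mono) auto
      with W_upper[OF that, of x] show ?thesis
        by simp
    qed
    have v_ge_vmin: "A * W x t powr (- (1 / m)) \<ge> vmin" if "t \<ge> 0" for x t
      unfolding vmin_def using A m W_le_D[OF that] W_pos[OF that] by (intro mult_left_mono powr_mono2') auto
    have ub_le: "ub x t \<le> M" if "t \<ge> 0" for x t
      unfolding ub_def M_def transform_def by (rule F_inv_le[OF vmin(1) v_ge_vmin[OF that]])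
    have ub_pos: "ub x t > 0" if "t \<ge> 0" for x t
      unfolding ub_def by (rule transform_pos[OF A(1) W_pos[OF that]])
    have ub_init: "ub x 0 \<ge> u0 x" for x
    proof -
      let ?B = "(1 + 0) + (norm x)\<^sup>2"
      have "W x 0 powr (- (1 / m)) \<le> (?B powr (-m)) powr (- (1 / m))"
        using W_lower[of 0 x] m by (intro powr_mono2') (auto simp: add_pos_nonneg less_imp_neq[THEN not_sym])
      also have "\<dots> = (norm x)\<^sup>2 + 1"
      proof -
        have "1 + (norm x)\<^sup>2 > 0"
          by (simp add: add_pos_nonneg)
        then show ?thesis
          using m by (auto simp: powr_powr add.commute)
      qed
      finally have "A * W x 0 powr (- (1 / m)) \<le> A * ((norm x)\<^sup>2 + 1)"
        using A by (intro mult_left_mono) auto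
      moreover have "A * W x 0 powr (- (1 / m)) > 0"
        using v_ge_vmin[of 0 x] vmin by simp
      ultimately show ?thesis
        unfolding ub_def transform_def u0 by (intro F_inv_le)
    qed
    have W_cont: "continuous_on (UNIV \<times> {0..}) (\<lambda>p. W (fst p) (snd p))"
    proof -
      have "1 + snd p + (norm (fst p))\<^sup>2 \<noteq> 0" "1 + snd p \<noteq> 0" if "p \<in> UNIV \<times> {0..}" for p :: "(real ^ 'n) \<times> real"
        using that by (auto simp: add_pos_nonneg less_imp_neq[THEN not_sym])
      then show ?thesis
        unfolding W_def barrier_def by (intro continuous_intros) auto
    qed
    have ub_cont: "continuous_on (UNIV \<times> {0..}) (\<lambda>p. ub (fst p) (snd p))"
      unfolding ub_def transform_def
    proof (intro continuous_on_compose2[OF F_inv_cont] continuous_on_mult continuous_on_const continuous_on_powr W_cont)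
      show "\<forall>p\<in>UNIV \<times> {0..}. W (fst p) (snd p) \<noteq> 0"
        using W_pos by (metis SigmaE atLeast_iff less_irrefl snd_conv)
      show "(\<lambda>p. A * W (fst p) (snd p) powr (- (1 / m))) ` (UNIV \<times> {0..}) \<subseteq> {0<..}"
        using A W_pos by (force simp: less_le)
    qed
    let ?s = "\<lambda>x::real ^ 'n. (norm x)\<^sup>2"
    define b1 where "b1 i x t = transform' A m (W x t) * (barrier_s m c K (?s x) (1 + t) * (2 * (x \<bullet> axis i 1)))" for i x t
    define b2 where "b2 i x t = transform'' A m (W x t) * (barrier_s m c K (?s x) (1 + t) * (2 * (x \<bullet> axis i 1)))\<^sup>2 +
      transform' A m (W x t) * (barrier_ss m c K (?s x) (1 + t) * (2 * (x \<bullet> axis i 1))\<^sup>2 + 2 * barrier_s m c K (?s x) (1 + t))" for i x t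
    define bt where "bt x t = transform' A m (W x t) * barrier_t m c K (?s x) (1 + t)" for x t
    have W_line: "((\<lambda>a. W (x + a *\<^sub>R e) t) has_real_derivative barrier_s m c K (?s x) (1 + t) * (2 * (x \<bullet> e))) (at 0)"
      if "t > 0" for x e t
    proof -
      have "((\<lambda>s. barrier m c K s (1 + t)) has_real_derivative barrier_s m c K (?s x) (1 + t)) (at (?s (x + 0 *\<^sub>R e)))"
        using barrier_s[of "?s x" "1 + t" m c K] that by simp
      from DERIV_chain2[OF this norm_sq_line_derivative] show ?thesis
        unfolding W_def .
    qed
    have b1: "((\<lambda>a. ub (x + a *\<^sub>R axis i 1) t) has_real_derivative b1 i x t) (at 0)" if "t > 0" for i x t
    proof -
      have "(transform A m has_real_derivative transform' A m (W x t)) (at (W (x + 0 *\<^sub>R axis i 1) t))"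
        using transform_deriv[OF A(1) m(1) W_pos[of t x]] that by simp
      from DERIV_chain2[OF this W_line[OF that]] show ?thesis
        unfolding ub_def b1_def .
    qed
    have b2: "((\<lambda>a. b1 i (x + a *\<^sub>R axis i 1) t) has_real_derivative b2 i x t) (at 0)" if t: "t > 0" for i x t
    proof -
      let ?e = "axis i 1 :: real ^ 'n"
      have "(transform' A m has_real_derivative transform'' A m (W x t)) (at (W (x + 0 *\<^sub>R ?e) t))"
        using transform'_deriv[OF A(1) m(1) W_pos[of t x]] that by simp
      note d1 = DERIV_chain2[OF this W_line[OF t]]
      have "((\<lambda>s. barrier_s m c K s (1 + t)) has_real_derivative barrier_ss m c K (?s x) (1 + t)) (at (?s (x + 0 *\<^sub>R ?e)))"
        using barrier_ss[of "?s x" "1 + t" m c K] t by simp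
      note d2 = DERIV_chain2[OF this norm_sq_line_derivative]
      have "((\<lambda>a. 2 * ((x + a *\<^sub>R ?e) \<bullet> ?e)) has_real_derivative 2) (at 0)"
        by (auto simp: inner_add_left inner_axis_axis intro!: derivative_eq_intros)
      from DERIV_mult[OF d1 DERIV_mult[OF d2 this]] show ?thesis
        unfolding b1_def b2_def by (rule DERIV_cong) (simp add: power2_eq_square algebra_simps)
    qed
    have bt: "((\<lambda>s. ub x s) has_real_derivative bt x t) (at t)" if t: "t > 0" for x t
    proof -
      have "((\<lambda>\<tau>. barrier m c K (?s x) \<tau>) has_real_derivative barrier_t m c K (?s x) (1 + t)) (at (1 + t))"
        using barrier_t[of "?s x" "1 + t" m c K] t by simp
      moreover have "((\<lambda>s. 1 + s) has_real_derivative 1) (at t)"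
        by (auto intro!: derivative_eq_intros)
      ultimately have "((\<lambda>s. W x s) has_real_derivative barrier_t m c K (?s x) (1 + t) * 1) (at t)"
        unfolding W_def by (rule DERIV_chain2)
      from DERIV_chain2[OF transform_deriv[OF A(1) m(1) W_pos] this] t show ?thesis
        unfolding ub_def bt_def by simp
    qed
    \<comment> \<open>By the chain rule the right side is \<open>transform'\<close> times the heat
      defect of W, minus \<open>transform''\<close> times |grad W|^2. Concavity makes the second
      contribution nonnegative, so the defect bound by B^(-m-1) alone must produce f(ub).\<close>
    have super: "f (ub x t) \<le> bt x t - (\<Sum>i\<in>UNIV. b2 i x t)" if t: "t > 0" for x t
    proof -
      let ?B = "(1 + t) + ?s x"
      let ?bs = "barrier_s m c K (?s x) (1 + t)" and ?bss = "barrier_ss m c K (?s x) (1 + t)"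
      have B: "?B \<ge> 1" and Wp: "W x t > 0"
        using B1[of t x] W_pos[of t x] t by auto
      have sq: "(\<Sum>i\<in>UNIV. (x \<bullet> axis i 1)\<^sup>2) = ?s x"
        unfolding power2_norm_eq_inner inner_vec_def[of x x] by (simp add: inner_axis power2_eq_square)
      have "(\<Sum>i\<in>UNIV. b2 i x t) = (\<Sum>i\<in>UNIV. (transform'' A m (W x t) * ?bs\<^sup>2 * 4 + transform' A m (W x t) * ?bss * 4) * (x \<bullet> axis i 1)\<^sup>2
          + transform' A m (W x t) * (2 * ?bs))"
        unfolding b2_def by (intro sum.cong refl) (simp add: power2_eq_square algebra_simps)
      also have "\<dots> = (transform'' A m (W x t) * ?bs\<^sup>2 * 4 + transform' A m (W x t) * ?bss * 4) * ?s x
          + N * (transform' A m (W x t) * (2 * ?bs))"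
        by (simp add: sum.distrib sum_distrib_left[symmetric] sq N_def)
      finally have sum: "bt x t - (\<Sum>i\<in>UNIV. b2 i x t) =
          transform' A m (W x t) * (barrier_t m c K (?s x) (1 + t) - (4 * ?s x * ?bss + 2 * N * ?bs))
          - transform'' A m (W x t) * (4 * ?bs\<^sup>2 * ?s x)"
        unfolding bt_def by algebra
      have fub: "f (ub x t) > 0"
        using ub_pos[of t x] t by (intro f_pos) simp
      have "f' (ub x t) * (A * W x t powr (- (1 / m))) \<le> m + 1"
        unfolding ub_def transform_def using v_ge_vmin[of t x] vmin t by (intro v0) auto
      then have "transform'' A m (W x t) \<le> 0"
        unfolding transform''_def ub_def[symmetric] using fub A by (intro mult_nonneg_nonpos) auto
      then have "transform'' A m (W x t) * (4 * ?bs\<^sup>2 * ?s x) \<le> 0"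
        by (intro mult_nonpos_nonneg) auto
      moreover have t'_nonneg: "transform' A m (W x t) \<ge> 0"
        unfolding transform'_def ub_def[symmetric] using fub A m by simp
      have "transform' A m (W x t) * ?B powr (-m-1) \<le>
          transform' A m (W x t) * (barrier_t m c K (?s x) (1 + t) - (4 * ?s x * ?bss + 2 * N * ?bs))"
        unfolding c_def
        by (rule mult_left_mono[OF barrier_supersolution t'_nonneg])
          (use m t K(2) in \<open>auto simp: \<kappa>_def c_def\<close>)
      moreover have "f (ub x t) \<le> transform' A m (W x t) * ?B powr (-m-1)"
      proof -
        have "(D * ?B powr (-m)) powr (- (1 / m) - 1) \<le> W x t powr (- (1 / m) - 1)"
          using W_upper[of t x] Wp m t by (intro powr_mono2') (auto simp: field_simps)
        moreover have "(D * ?B powr (-m)) powr (- (1 / m) - 1) = D powr (- (1 / m) - 1) * ?B powr (1 + m)"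
        proof -
          have "(- m) * (- (1 / m) - 1) = 1 + m"
            using m by (simp add: field_simps)
          then show ?thesis
            using D B by (simp only: powr_mult powr_powr)
        qed
        ultimately have "D powr (- (1 / m) - 1) * ?B powr (1 + m) * ?B powr (-m-1) \<le> W x t powr (- (1 / m) - 1) * ?B powr (-m-1)"
          by (intro mult_right_mono) auto
        moreover have "?B powr (1 + m) * ?B powr (-m-1) = 1"
          using B by (simp add: powr_add[symmetric])
        ultimately have *: "D powr (- (1 / m) - 1) \<le> W x t powr (- (1 / m) - 1) * ?B powr (-m-1)"
          by (simp add: mult.assoc)
        \<comment> \<open>The upper bound W <= D B^(-m) makes the powers of B cancel, so the
          remaining requirement is the constant inequality A >= m D^(1/m+1).\<close>
        have "1 = (A / m) * D powr (- (1 / m) - 1) * (m * D powr (1 / m + 1) / A)"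
          using A m D by (simp add: powr_add[symmetric])
        also have "\<dots> \<le> (A / m) * D powr (- (1 / m) - 1) * 1"
          using A m by (intro mult_left_mono) auto
        also have "\<dots> \<le> (A / m) * (W x t powr (- (1 / m) - 1) * ?B powr (-m-1))"
          using * A m by (simp add: mult_left_mono divide_right_mono)
        finally have "f (ub x t) * 1 \<le> f (ub x t) * ((A / m) * (W x t powr (- (1 / m) - 1) * ?B powr (-m-1)))"
          using fub by (intro mult_left_mono) auto
        then show ?thesis
          unfolding transform'_def ub_def by (simp add: mult_ac)
      qed
      ultimately show ?thesis
        unfolding sum by linarith
    qed
    have w_le: "w x t \<le> ub x t" if "t \<ge> 0" for x t
    proof -
      have "ub x t - w x t \<ge> 0"
      proof (rule comparison_principle[where z = "\<lambda>x t. ub x t - w x t" and zx = "\<lambda>i x t. b1 i x t - w1 i x t" and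
            zxx = "\<lambda>i x t. b2 i x t - w2 i x t" and zt = "\<lambda>x t. bt x t - ((\<Sum>i\<in>UNIV. w2 i x t) + g (w x t))",
            OF L0 _ _ _ _ _ _ _ that])
        show "continuous_on (UNIV \<times> {0..}) (\<lambda>(x, t). ub x t - w x t)"
          using ub_cont w_cont by (auto simp: split_beta intro!: continuous_intros)
        show "\<exists>C. \<forall>x. \<forall>t\<in>{0..T}. C \<le> ub x t - w x t" for T
        proof -
          obtain C where C: "\<forall>x. \<forall>t\<in>{0..T}. \<bar>w x t\<bar> \<le> C"
            using w_bounded by blast
          have "- C \<le> ub x t - w x t" if "t \<in> {0..T}" for x t
          proof -
            have "\<bar>w x t\<bar> \<le> C" "ub x t > 0"
              using C that ub_pos[of t x] by auto
            then show ?thesis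
              by linarith
          qed
          then show ?thesis
            by blast
        qed
        show "ub x 0 - w x 0 \<ge> 0" for x
          using ub_init[of x] by (simp add: w_init)
        fix x :: "real ^ 'n" and t :: real
        assume t: "t > 0"
        show "((\<lambda>s. ub x s - w x s) has_real_derivative bt x t - ((\<Sum>i\<in>UNIV. w2 i x t) + g (w x t))) (at t)"
          by (intro DERIV_diff bt wt t)
        show "((\<lambda>a. ub (x + a *\<^sub>R axis i 1) t - w (x + a *\<^sub>R axis i 1) t) has_real_derivative b1 i x t - w1 i x t) (at 0)" for i
          by (intro DERIV_diff b1 w1 t)
        show "((\<lambda>a. b1 i (x + a *\<^sub>R axis i 1) t - w1 i (x + a *\<^sub>R axis i 1) t) has_real_derivative b2 i x t - w2 i x t) (at 0)" for i
          by (intro DERIV_diff b2 w2 t)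
        assume neg: "ub x t - w x t < 0"
        \<comment> \<open>Only \<open>ub\<close> is known to lie in (0,M] here; \<open>w\<close> may
          still exceed M, so the comparison is run with the Lipschitz function
          \<open>g\<close>.\<close>
        have "g (ub x t) = f (ub x t)"
          using ub_pos[of t x] ub_le[of t x] t by (intro g_eq) auto
        moreover have "L * (ub x t - w x t) \<le> g (ub x t) - g (w x t)"
          using lip[of "ub x t" "w x t"] neg by (simp add: abs_le_iff algebra_simps)
        ultimately show "L * (ub x t - w x t) \<le>
            bt x t - ((\<Sum>i\<in>UNIV. w2 i x t) + g (w x t)) - (\<Sum>i\<in>UNIV. b2 i x t - w2 i x t)"
          using super[OF t, of x] by (simp add: sum_subtractf)
      qed
      then show ?thesis
        by simp
    qed
    have w_M: "w x t \<le> M" if "t \<ge> 0" for x t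
      using w_le[OF that] ub_le[OF that] order_trans by blast
    have "bounded ((\<lambda>(x, t). w x t) ` (UNIV \<times> {0..T}))" for T
      unfolding bounded_iff using w_nonneg w_M by (intro exI[of _ M]) auto
    moreover have "deriv (\<lambda>s. w x s) t = laplacian (\<lambda>y. w y t) x + f (w x t)" if "t > 0" for x t
      using pde[OF that, of x] g_eq[OF w_nonneg[of t x] w_M[of t x]] that by simp
    ultimately have "global_solution f u0 w"
      unfolding global_solution_def using C21 w_cont w_nonneg w_init by blast
    then show ?thesis
      by blast
  qed
  moreover have "A0 > 0"
    using Max_ge[of "{1, v0, v0 * D powr (1 / m), m * D powr (1 / m + 1)}" 1] by (simp add: A0_def)
  ultimately show ?thesis
    by (intro exI[of _ A0]) auto
qed

end

theorem theorem1p1: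
  fixes f f' f'' :: "real \<Rightarrow> real" and q :: real
  assumes f_C1: "\<And>u. u \<ge> 0 \<Longrightarrow> (f has_real_derivative f' u) (at u within {0..})"
    and f'_cont: "continuous_on {0..} f'"
    and f_C2: "\<And>u. u > 0 \<Longrightarrow> (f' has_real_derivative f'' u) (at u)"
    and f''_cont: "continuous_on {0<..} f''"
    and f_0: "f 0 = 0"
    and f_pos: "\<And>u. u > 0 \<Longrightarrow> f u > 0"
    and f'_pos: "\<And>u. u > 0 \<Longrightarrow> f' u > 0"
    and f''_pos: "\<And>u. u > 0 \<Longrightarrow> f'' u > 0"
    and F_finite: "\<And>u. u > 0 \<Longrightarrow> set_integrable lborel {u..} (\<lambda>s. 1 / f s)"
    and q_lim: "((\<lambda>s. f' s * F_of f s) \<longlongrightarrow> q) (at_right 0)"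
    and q_less: "q < 1 + real CARD('n::finite) / 2"
  shows "\<exists>\<gamma>0>0. \<forall>\<gamma>. 0 < \<gamma> \<and> \<gamma> < \<gamma>0 \<longrightarrow>
           (\<exists>u :: real ^ 'n \<Rightarrow> real \<Rightarrow> real.
              global_solution f (\<lambda>x. F_inv f (((norm x)\<^sup>2 + 1) / \<gamma>)) u)"
proof -
  interpret superlinear f f' f''
    by unfold_locales (fact f_C1 f'_cont f_C2 f_0 f_pos f''_pos F_finite)+
  let ?N = "real CARD('n)"
  \<comment> \<open>The hypothesis on \<open>q\<close> and N >= 1 leave room for an m strictly in
    between; strictness above q - 1 turns the limit into a bound on a whole interval (0,b).\<close>
  have "max (q - 1) 0 < ?N / 2"
    unfolding max_less_iff_conj using q_less by auto
  then obtain m where "max (q - 1) 0 < m" and mN: "m < ?N / 2"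
    using dense by blast
  then have m: "m > 0" and q: "q < m + 1"
    by auto
  obtain b where b: "b > 0" "\<And>s. 0 < s \<Longrightarrow> s < b \<Longrightarrow> f' s * F_of f s < m + 1"
    using order_tendstoD(2)[OF q_lim q] unfolding eventually_at_right_field by auto
  define v0 where "v0 = F_of f b"
  have v0: "f' (F_inv f v) * v \<le> m + 1" if v: "v > v0" "v > 0" for v
  proof -
    have "F_inv f v < b"
      using F_less_iff[of "F_inv f v" b] v b F_inv_pos[of v] F_F_inv[of v] by (simp add: v0_def)
    then show ?thesis
      using b(2)[of "F_inv f v"] F_inv_pos[of v] F_F_inv[of v] v by simp
  qed
  obtain A0 where A0: "A0 > 0" "\<And>A. A > A0 \<Longrightarrow> \<exists>u :: real ^ 'n \<Rightarrow> real \<Rightarrow> real.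
      global_solution f (\<lambda>x. F_inv f (A * ((norm x)\<^sup>2 + 1))) u"
    using global_solution_exists[OF m mN v0] by blast
  show ?thesis
  proof (intro exI[of _ "1 / A0"] conjI allI impI)
    show "1 / A0 > 0"
      using A0(1) by simp
    fix \<gamma>
    assume \<gamma>: "0 < \<gamma> \<and> \<gamma> < 1 / A0"
    then have "1 / \<gamma> > A0"
      using A0(1) by (simp add: field_simps)
    from A0(2)[OF this]
    show "\<exists>u :: real ^ 'n \<Rightarrow> real \<Rightarrow> real. global_solution f (\<lambda>x. F_inv f (((norm x)\<^sup>2 + 1) / \<gamma>)) u"
      by simp
  qed
qed

end
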